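(* Let $p$ be a balanced ip-function generator on weighted graphs, and let $(G,f)$, $(G',f')$ be two weighted graphs. Let $D(f)$ and $D(f')$ be the persistence diagrams of the ip-functions $p_{(G,f)}$ and $p_{(G',f')}$. Then \[ d\big(D(f),D(f')\big)\le \delta\big((G,f),(G',f')\big), \] where $d$ is the bottleneck distance and $\delta$ the natural pseudodistance.
   Context: Graphs are finite simple undirected graphs $G=(V,E)$. A weighted graph is a pair $(G,f)$ with $f:E\to\mathbb{R}$. For $u\in\mathbb{R}$, $G_u$ denotes the subgraph of $G$ induced by the edge set $f^{-1}((-\infty,u])$ (its vertices are the endpoints of these edges), and $G_{+\infty}=G$. Let $\Delta^+=\{(u,v)\in\mathbb{R}\times(\mathbb{R}\cup\{+\infty\}) : u<v\}$ and $\Delta=\{(u,u)\}$. A categorical persistence function (on $(\mathbb{R},\le)$) is a lower-bounded function $p:\Delta^+\to\mathbb{Z}$ such that for all $u_1\le u_2<v_1\le v_2$: (1) $p(u_1,v_1)\le p(u_2,v_1)$ and $p(u_2,v_2)\le p(u_2,v_1)$; (2) $p(u_2,v_1)-p(u_1,v_1)\ge p(u_2,v_2)-p(u_1,v_2)$. An ip-function generator is a map $p$ assigning to every weighted graph $(G,f)$ a categorical persistence function $p_{(G,f)}$ (called an ip-function), such that $p_{(G,f)}=p_{(G',f')}$ whenever the filtrations $\{G_u\}$ and $\{G'_u\}$ are naturally isomorphic (e.g. when there is a graph isomorphism $\psi:G\to G'$ with $f=f'\circ\psi$). It is balanced if: whenever $(G,f)$, $(G',f')$ are weighted graphs, $\psi:G\to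 G'$ is a graph isomorphism and $h>0$ satisfies $\sup_{e\in E}|f(e)-f'(\psi(e))|\le h$, then $p_{(G,f)}(u-h,v+h)\le p_{(G',f')}(u,v)$ for all $(u,v)\in\Delta^+$ (with $+\infty+h=+\infty$). Persistence diagram of a categorical persistence function $p$: for $(u,v)\in\Delta^+$ with $v<\infty$, its multiplicity is $\mu(u,v)=\min_{\varepsilon>0,\,u+\varepsilon<v-\varepsilon}\big[p(u+\varepsilon,v-\varepsilon)-p(u-\varepsilon,v-\varepsilon)-p(u+\varepsilon,v+\varepsilon)+p(u-\varepsilon,v+\varepsilon)\big]$, and $\mu(u,+\infty)=\min_{\varepsilon>0,\,u+\varepsilon<1/\varepsilon}\big[p(u+\varepsilon,1/\varepsilon)-p(u-\varepsilon,1/\varepsilon)\big]$. The diagram is the multiset consisting of the points of $\Delta^+$ with multiplicity $\mu$ (cornerpoints) together with all points of $\Delta$, each with infinite multiplicity. Bottleneck distance: $d(D,D')=\inf_{\gamma}\sup_{x\in D}\|x-\gamma(x)\|_\infty$, the infimum over all bijections $\gamma:D\to D'$ of multisets (with $\infty-\infty=0$). Natural pseudodistance: $\delta((G,f),(G',f'))=+\infty$ if there is no graph isomorphism $G\to G'$; otherwise $\delta=\inf_{\phi}\sup_{e\in E}|f(e)-f'(\phi(e))|$, the infimum over graph isomorphisms $\phi:G\to G'$. *)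

theory Defs
  imports "HOL-Library.Extended_Real"
begin

text \<open>A graph is a pair (V, E) of a vertex set and a set of edges, each edge being
a two-element subset of V. A weighted graph is a graph G together with f, where only
the values of f on the edges of G are relevant.\<close>

type_synonym 'v graph = "'v set \<times> 'v set set"

definition simple_graph :: "'v graph \<Rightarrow> bool" where
  "simple_graph G \<longleftrightarrow> finite (fst G) \<and>
     snd G \<subseteq> {{x, y} | x y. x \<in> fst G \<and> y \<in> fst G \<and> x \<noteq> y}"

definition graph_iso :: "('v \<Rightarrow> 'w) \<Rightarrow> 'v graph \<Rightarrow> 'w graph \<Rightarrow> bool" where
  "graph_iso \<phi> G G' \<longleftrightarrow> bij_betw \<phi> (fst G) (fst G') \<and>
     (\<forall>x\<in>fst G. \<forall>y\<in>fst G. {x, y} \<in> snd G \<longleftrightarrow> {\<phi> x, \<phi> y} \<in> snd G')"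

text \<open>Sublevel graph G_u (u real) induced by the edges of weight at most u;
G_{+\<infinity>} = G. (The value -\<infinity> is never used.)\<close>

definition sublevel :: "'v graph \<Rightarrow> ('v set \<Rightarrow> real) \<Rightarrow> ereal \<Rightarrow> 'v graph" where
  "sublevel G f u = (if u = \<infinity> then G
     else (\<Union>{e \<in> snd G. ereal (f e) \<le> u}, {e \<in> snd G. ereal (f e) \<le> u}))"

definition nat_iso_filtrations ::
  "'v graph \<Rightarrow> ('v set \<Rightarrow> real) \<Rightarrow> 'v graph \<Rightarrow> ('v set \<Rightarrow> real) \<Rightarrow> bool" where
  "nat_iso_filtrations G f G' f' \<longleftrightarrow> (\<exists>\<psi> :: ereal \<Rightarrow> 'v \<Rightarrow> 'v.
     (\<forall>u. u \<noteq> -\<infinity> \<longrightarrow> graph_iso (\<psi> u) (sublevel G f u) (sublevel G' f' u)) \<and>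
     (\<forall>u v. u \<noteq> -\<infinity> \<longrightarrow> u \<le> v \<longrightarrow> (\<forall>x \<in> fst (sublevel G f u). \<psi> v x = \<psi> u x)))"

text \<open>A function on \<Delta>^+ = {(u,v). u real, v in R \<union> {+\<infinity>}, u < v} is represented as
a function real \<Rightarrow> ereal \<Rightarrow> int; only the values with ereal u < v matter.\<close>

definition categorical_pf :: "(real \<Rightarrow> ereal \<Rightarrow> int) \<Rightarrow> bool" where
  "categorical_pf p \<longleftrightarrow>
     (\<exists>m. \<forall>u v. ereal u < v \<longrightarrow> m \<le> p u v) \<and>
     (\<forall>u1 u2 v1 v2. u1 \<le> u2 \<longrightarrow> ereal u2 < v1 \<longrightarrow> v1 \<le> v2 \<longrightarrow>
        p u1 v1 \<le> p u2 v1 \<and> p u2 v2 \<le> p u2 v1 \<and>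
        p u2 v1 - p u1 v1 \<ge> p u2 v2 - p u1 v2)"

type_synonym 'v generator = "'v graph \<Rightarrow> ('v set \<Rightarrow> real) \<Rightarrow> real \<Rightarrow> ereal \<Rightarrow> int"

definition ip_generator :: "'v generator \<Rightarrow> bool" where
  "ip_generator P \<longleftrightarrow>
     (\<forall>G f. simple_graph G \<longrightarrow> categorical_pf (P G f)) \<and>
     (\<forall>G f G' f'. simple_graph G \<longrightarrow> simple_graph G' \<longrightarrow>
        nat_iso_filtrations G f G' f' \<longrightarrow>
        (\<forall>u v. ereal u < v \<longrightarrow> P G f u v = P G' f' u v))"

definition balanced :: "'v generator \<Rightarrow> bool" where
  "balanced P \<longleftrightarrow>
     (\<forall>G f G' f' \<psi> h. simple_graph G \<longrightarrow> simple_graph G' \<longrightarrow> graph_iso \<psi> G G' \<longrightarrow>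
        h > 0 \<longrightarrow> (\<forall>e \<in> snd G. \<bar>f e - f' (\<psi> ` e)\<bar> \<le> h) \<longrightarrow>
        (\<forall>u v. ereal u < v \<longrightarrow> P G f (u - h) (v + ereal h) \<le> P G' f' u v))"

definition multiplicity :: "(real \<Rightarrow> ereal \<Rightarrow> int) \<Rightarrow> real \<Rightarrow> ereal \<Rightarrow> nat" where
  "multiplicity p u v = (if v = \<infinity> then
       nat (Inf {p (u + \<epsilon>) (ereal (1 / \<epsilon>)) - p (u - \<epsilon>) (ereal (1 / \<epsilon>)) | \<epsilon>.
                  \<epsilon> > 0 \<and> u + \<epsilon> < 1 / \<epsilon>})
     else
       nat (Inf {p (u + \<epsilon>) (ereal (real_of_ereal v - \<epsilon>)) - p (u - \<epsilon>) (ereal (real_of_ereal v - \<epsilon>))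
                 - p (u + \<epsilon>) (ereal (real_of_ereal v + \<epsilon>)) + p (u - \<epsilon>) (ereal (real_of_ereal v + \<epsilon>)) | \<epsilon>.
                  \<epsilon> > 0 \<and> u + \<epsilon> < real_of_ereal v - \<epsilon>}))"

text \<open>The persistence diagram as a multiset, represented by labelled points:
a point x of multiplicity m is represented by the copies (x,0),...,(x,m-1);
points of the diagonal (u,u) have infinitely many copies (x,k), k \<in> nat.\<close>

definition diagram :: "(real \<Rightarrow> ereal \<Rightarrow> int) \<Rightarrow> ((real \<times> ereal) \<times> nat) set" where
  "diagram p = {((u, v), k) | u v k. ereal u < v \<and> k < multiplicity p u v}
             \<union> {((u, ereal u), k) | u k. True}"

definition vdist :: "ereal \<Rightarrow> ereal \<Rightarrow> ereal" where
  "vdist v v' = (if v = \<infinity> \<and> v' = \<infinity> then 0 else \<bar>v - v'\<bar>)"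

definition pdist :: "real \<times> ereal \<Rightarrow> real \<times> ereal \<Rightarrow> ereal" where
  "pdist x y = max (ereal \<bar>fst x - fst y\<bar>) (vdist (snd x) (snd y))"

definition bottleneck :: "((real \<times> ereal) \<times> nat) set \<Rightarrow> ((real \<times> ereal) \<times> nat) set \<Rightarrow> ereal" where
  "bottleneck D D' = Inf {Sup {pdist (fst x) (fst (\<gamma> x)) | x. x \<in> D} | \<gamma>. bij_betw \<gamma> D D'}"

text \<open>Sup over the (possibly empty) edge set is taken with 0 included (values are \<ge> 0).\<close>

definition natural_pseudodistance ::
  "'v graph \<Rightarrow> ('v set \<Rightarrow> real) \<Rightarrow> 'v graph \<Rightarrow> ('v set \<Rightarrow> real) \<Rightarrow> ereal" where
  "natural_pseudodistance G f G' f' = (if \<not> (\<exists>\<phi>. graph_iso \<phi> G G') then \<infinity>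
     else Inf {Sup (insert 0 {ereal \<bar>f e - f' (\<phi> ` e)\<bar> | e. e \<in> snd G}) | \<phi>. graph_iso \<phi> G G'})"

end

theory Submission
  imports "HOL-Analysis.Analysis" Defs
begin

text \<open>If an isomorphism \<phi> satisfies |f e - f' (\<phi> e)| \<le> h, the weights
g t = (1 - t) f + t (f' \<circ> \<phi>) on G give a path of persistence functions from p_(G,f) to
p_(G',f') along which times s and t are interleaved by h |s - t|. The rank inequalities of an
interleaving alone do not bound the bottleneck distance, but locally they do: if the second function
is interleaved with the first by a small \<eta>, then near a point of multiplicity m it has exactly
m cornerpoints, all within distance \<eta>. Hence for a finite set A of points
that lie further than h from the diagonal, the number of cornerpoints at time t within
distance t h of A is nondecreasing in t, and at t = 1 this is Hall's
condition for matching the cornerpoints far from the diagonal. Diagrams may be infinite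
but are locally finite away from the diagonal, so the infinite marriage theorem applies; doing this in
both directions, sending cornerpoints close to the diagonal to the diagonal, and applying
Schroeder-Bernstein yields a bijection moving points by at most h.\<close>

text \<open>The constant \<open>2 * h\<close> appears because the point (u,v) has sup-norm distance
  (v - u) / 2 from the diagonal. A point with v - u > 2 h that moves by at most h stays strictly
  above the diagonal, where cornerpoints are locally finite. The axioms impose no continuity on p.
  Replacing p by \<open>reg p\<close> supplies it on one side: integer values and monotonicity make
  \<open>reg p\<close> constant on each of the four quadrants in a small square around a point of
  finite height. The multiplicity is the alternating sum of these four constants, and box counts are
  alternating sums of \<open>reg p\<close> at the corners of the box. An interleaving by a small
  \<eta> traps the second function between two values from the same quadrant, so it is determined
  there exactly; this turns rank inequalities into an exact local count. The radius t h grows at the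
  same rate as the interleaving parameter, so a cornerpoint following the path stays counted. How
  small a time step must be depends on the time, so the count is compared locally from the left (by
  compactness) and from the right (by separation of finitely many points), and the comparisons are
  glued by the induction \<open>Bolzano\<close> on [0,1].\<close>

section \<open>Marriage and Schroeder-Bernstein theorems\<close>

text \<open>Rado's argument: in a minimal subfamily satisfying Hall's condition all sets are
singletons. Zorn's lemma is applied to the complements.\<close>

lemma infinite_Hall:
  fixes A :: "'i \<Rightarrow> 'a set"
  assumes fin: "\<And>i. i \<in> I \<Longrightarrow> finite (A i)"
    and hall: "\<And>J. J \<subseteq> I \<Longrightarrow> finite J \<Longrightarrow> card J \<le> card (\<Union>(A ` J))"
  shows "\<exists>f. inj_on f I \<and> (\<forall>i\<in>I. f i \<in> A i)"
proof -
  define S where "S = Sigma I A"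
  define good where "good E \<longleftrightarrow> (\<forall>J. J \<subseteq> I \<longrightarrow> finite J \<longrightarrow> card J \<le> card (E `` J))"
    for E :: "('i \<times> 'a) set"
  define \<R> where "\<R> = {R. R \<subseteq> S \<and> good (S - R)}"
  have finS: "finite (E `` J)" if "J \<subseteq> I" "finite J" "E \<subseteq> S" for E J
  proof -
    have "E `` J \<subseteq> \<Union>(A ` J)" using that by (auto simp: S_def)
    moreover have "finite (\<Union>(A ` J))" using that fin by auto
    ultimately show ?thesis by (rule finite_subset)
  qed
  have "\<exists>M\<in>\<R>. \<forall>X\<in>\<R>. M \<subseteq> X \<longrightarrow> X = M"
  proof (rule subset_Zorn_nonempty)
    have "S `` J = \<Union>(A ` J)" if "J \<subseteq> I" for J using that by (auto simp: S_def)
    then have "{} \<in> \<R>" using hall by (simp add: \<R>_def good_def)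
    then show "\<R> \<noteq> {}" by blast
  next
    fix C assume C: "C \<noteq> {}" "subset.chain \<R> C"
    then have sub: "C \<subseteq> \<R>" by (simp add: subset_chain_def)
    have "card J \<le> card ((S - \<Union>C) `` J)" if J: "J \<subseteq> I" "finite J" for J
    proof -
      \<comment> \<open>Only finitely many edges start in \<open>J\<close>, so all of them that the
        chain deletes are already deleted by a single member \<open>R\<close>, for which Hall's
        condition holds.\<close>
      have "finite (Sigma J A \<inter> \<Union>C)" using J fin by auto
      then obtain R where R: "R \<in> C" "Sigma J A \<inter> \<Union>C \<subseteq> R"
        by (rule finite_subset_Union_chain[OF _ _ C]) auto
      then have "(S - R) `` J \<subseteq> (S - \<Union>C) `` J" using J by (auto simp: S_def)
      moreover have "card J \<le> card ((S - R) `` J)"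
        using R sub J by (auto simp: \<R>_def good_def)
      ultimately show ?thesis using finS[OF J, of "S - \<Union>C"]
        by (meson Diff_subset card_mono order_trans)
    qed
    then show "\<Union>C \<in> \<R>" using sub by (auto simp: \<R>_def good_def)
  qed
  then obtain M where M: "M \<in> \<R>" and max: "\<And>X. X \<in> \<R> \<Longrightarrow> M \<subseteq> X \<Longrightarrow> X = M" by blast
  define E where "E = S - M"
  have ES: "E \<subseteq> S" and gE: "\<And>J. J \<subseteq> I \<Longrightarrow> finite J \<Longrightarrow> card J \<le> card (E `` J)"
    using M by (auto simp: E_def \<R>_def good_def)
  \<comment> \<open>By minimality of \<open>E\<close>, deleting (i, x) violates Hall's condition at
    some set, necessarily containing i. Here i has been taken out of that set, so the strict
    inequality becomes \<open>\<le> card J\<close>.\<close>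
  have crit: "\<exists>J. J \<subseteq> I \<and> finite J \<and> i \<notin> J \<and> card (E `` J \<union> (E `` {i} - {x})) \<le> card J"
    if x: "(i, x) \<in> E" for i x
  proof -
    have "insert (i, x) M \<notin> \<R>" using max[of "insert (i, x) M"] x by (auto simp: E_def)
    then have "\<not> good (S - insert (i, x) M)" using x M by (auto simp: \<R>_def E_def)
    moreover have "S - insert (i, x) M = E - {(i, x)}" by (auto simp: E_def)
    ultimately obtain J where J: "J \<subseteq> I" "finite J" "card ((E - {(i, x)}) `` J) < card J"
      unfolding good_def by (metis not_le)
    have iJ: "i \<in> J"
    proof (rule ccontr)
      assume "i \<notin> J"
      then have "(E - {(i, x)}) `` J = E `` J" by auto
      then show False using J gE[of J] by simp
    qed
    have "(E - {(i, x)}) `` J = E `` (J - {i}) \<union> (E `` {i} - {x})" using iJ by auto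
    moreover have "card J = Suc (card (J - {i}))" using iJ J by (simp add: card_Suc_Diff1)
    ultimately show ?thesis using J by (intro exI[of _ "J - {i}"]) auto
  qed
  have single: "\<exists>x. E `` {i} = {x}" if i: "i \<in> I" for i
  proof -
    have "card (E `` {i}) \<ge> 1" using gE[of "{i}"] i by simp
    then have "E `` {i} \<noteq> {}" by force
    moreover have "x = y" if xy: "(i, x) \<in> E" "(i, y) \<in> E" for x y
    proof (rule ccontr)
      assume "x \<noteq> y"
      obtain J where J: "J \<subseteq> I" "finite J" "i \<notin> J" "card (E `` J \<union> (E `` {i} - {x})) \<le> card J"
        using crit xy by blast
      obtain K where K: "K \<subseteq> I" "finite K" "i \<notin> K" "card (E `` K \<union> (E `` {i} - {y})) \<le> card K"
        using crit xy by blast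
      \<comment> \<open>Submodularity: Hall's condition gives |P Un Q| > |J Un K| and |P Int Q| >=
        |J Int K|, while |P| + |Q| <= |J| + |K|; adding up is contradictory.\<close>
      let ?P = "E `` J \<union> (E `` {i} - {x})" and ?Q = "E `` K \<union> (E `` {i} - {y})"
      have fP: "finite ?P" "finite ?Q" using finS ES i J K by auto
      have "?P \<union> ?Q = E `` (insert i (J \<union> K))" using \<open>x \<noteq> y\<close> by auto
      moreover have "card (insert i (J \<union> K)) \<le> card (E `` (insert i (J \<union> K)))"
        using J K i by (intro gE) auto
      moreover have "card (insert i (J \<union> K)) = Suc (card (J \<union> K))" using J K by simp
      ultimately have 1: "Suc (card (J \<union> K)) \<le> card (?P \<union> ?Q)" by (simp only:)
      have "card (J \<inter> K) \<le> card (E `` (J \<inter> K))" using gE[of "J \<inter> K"] J by auto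
      also have "\<dots> \<le> card (?P \<inter> ?Q)" using fP by (intro card_mono) auto
      finally have 2: "card (J \<inter> K) \<le> card (?P \<inter> ?Q)" .
      show False using 1 2 card_Un_Int[OF fP] card_Un_Int[OF J(2) K(2)] J(4) K(4) by linarith
    qed
    ultimately show ?thesis by blast
  qed
  then obtain f where f: "\<And>i. i \<in> I \<Longrightarrow> E `` {i} = {f i}" by metis
  have "inj_on f I"
  proof (rule inj_onI, rule ccontr)
    fix i j assume ij: "i \<in> I" "j \<in> I" "f i = f j" "i \<noteq> j"
    have "E `` {i, j} = {f i}" using f[of i] f[of j] ij by auto
    then show False using gE[of "{i, j}"] ij by simp
  qed
  moreover have "f i \<in> A i" if "i \<in> I" for i using f[OF that] ES by (auto simp: S_def)
  ultimately show ?thesis by blast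
qed

text \<open>The bijection built from the Knaster-Tarski fixed point only uses pairs (a, f a) and (g
  b, b), so it inherits every relation \<open>Q\<close> that holds for these pairs. With
  \<open>Q\<close> a distance bound, the bound survives.\<close>

lemma Schroeder_Bernstein_related:
  assumes f: "inj_on f A" "f ` A \<subseteq> B" and g: "inj_on g B" "g ` B \<subseteq> A"
    and Qf: "\<And>a. a \<in> A \<Longrightarrow> Q a (f a)" and Qg: "\<And>b. b \<in> B \<Longrightarrow> Q (g b) b"
  shows "\<exists>h. bij_betw h A B \<and> (\<forall>a\<in>A. Q a (h a))"
proof -
  define X where "X = lfp (\<lambda>X. A - g ` (B - f ` X))"
  have X: "X = A - g ` (B - f ` X)"
    unfolding X_def by (rule lfp_unfold, unfold mono_def) blast
  then have XA: "X \<subseteq> A" and AX: "A - X = g ` (B - f ` X)" using g by auto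
  define h where "h a = (if a \<in> X then f a else inv_into (B - f ` X) g a)" for a
  have gi: "inj_on g (B - f ` X)" using g(1) by (rule inj_on_subset) auto
  have b1: "bij_betw h X (f ` X)"
    using inj_on_subset[OF f(1) XA] by (auto simp: bij_betw_def h_def inj_on_def)
  have "bij_betw (inv_into (B - f ` X) g) (A - X) (B - f ` X)"
    unfolding AX by (intro bij_betw_inv_into) (simp add: bij_betw_def gi)
  then have b2: "bij_betw h (A - X) (B - f ` X)"
    by (rule bij_betw_cong[THEN iffD1, rotated]) (simp add: h_def)
  have "bij_betw h (X \<union> (A - X)) (f ` X \<union> (B - f ` X))"
    using b1 b2 by (rule bij_betw_combine) auto
  moreover have "X \<union> (A - X) = A" "f ` X \<union> (B - f ` X) = B" using XA f by auto
  moreover have "Q a (h a)" if "a \<in> A" for a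
  proof (cases "a \<in> X")
    case True then show ?thesis using Qf that by (simp add: h_def)
  next
    case False
    then have "a \<in> g ` (B - f ` X)" using that AX by auto
    then have "g (h a) = a" "h a \<in> B" using False
      by (auto simp: h_def f_inv_into_f inv_into_into gi)
    then show ?thesis using Qg by metis
  qed
  ultimately show ?thesis by auto
qed

section \<open>Regularization of persistence functions\<close>

lemma int_set_has_least:
  fixes S :: "int set"
  assumes "x \<in> S" "\<forall>s\<in>S. m \<le> s"
  shows "\<exists>k\<in>S. \<forall>s\<in>S. k \<le> s"
proof -
  obtain k where k: "k \<in> S" "\<And>s. s \<in> S \<Longrightarrow> nat (k - m) \<le> nat (s - m)"
    using ex_has_least_nat[of "\<lambda>s. s \<in> S" x "\<lambda>s. nat (s - m)"] assms(1) by auto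
  have "k \<le> s" if "s \<in> S" for s
    using k(2)[OF that] assms(2) that k(1) by fastforce
  then show ?thesis using k(1) by blast
qed

lemma int_set_has_greatest:
  fixes S :: "int set"
  assumes "x \<in> S" "\<forall>s\<in>S. s \<le> m"
  shows "\<exists>k\<in>S. \<forall>s\<in>S. s \<le> k"
  using int_set_has_least[of "- x" "uminus ` S" "- m"] assms by auto

hide_const (open) Factorial_Ring.multiplicity

definition corners :: "(real \<Rightarrow> ereal \<Rightarrow> int) \<Rightarrow> ((real \<times> ereal) \<times> nat) set" where
  "corners p = {((u, v), k) | u v k. ereal u < v \<and> k < multiplicity p u v}"

text \<open>The right- and left-continuous version of p, through which alone p enters its diagram. At
v = \<infinity> it is a limit over finite v and may differ from p u \<infinity>.\<close>

definition reg :: "(real \<Rightarrow> ereal \<Rightarrow> int) \<Rightarrow> real \<Rightarrow> ereal \<Rightarrow> int" where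
  "reg p u v = Inf {p a (ereal b) | a b. u < a \<and> a < b \<and> ereal b < v}"

locale cpf =
  fixes p :: "real \<Rightarrow> ereal \<Rightarrow> int"
  assumes cat: "categorical_pf p"
begin

lemma mono_u: "u1 \<le> u2 \<Longrightarrow> ereal u2 < v \<Longrightarrow> p u1 v \<le> p u2 v"
  using cat unfolding categorical_pf_def by blast

lemma anti_v: "ereal u < v1 \<Longrightarrow> v1 \<le> v2 \<Longrightarrow> p u v2 \<le> p u v1"
  using cat unfolding categorical_pf_def by blast

lemma diff: "u1 \<le> u2 \<Longrightarrow> ereal u2 < v1 \<Longrightarrow> v1 \<le> v2 \<Longrightarrow> p u2 v2 - p u1 v2 \<le> p u2 v1 - p u1 v1"
  using cat unfolding categorical_pf_def by blast

lemma lower_bound: obtains m where "\<And>u v. ereal u < v \<Longrightarrow> m \<le> p u v"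
  using cat unfolding categorical_pf_def by blast

text \<open>A nonempty set of integers bounded below attains its infimum. Moving a towards u and b
  towards v can only lower p, so the minimal value persists there and is the limit of p at (u+,
  v-).\<close>

lemma reg_attained:
  assumes uv: "ereal u < v"
  obtains a0 b0 where "u < a0" "a0 < b0" "ereal b0 < v"
    "\<And>a b. u < a \<Longrightarrow> a \<le> a0 \<Longrightarrow> b0 \<le> b \<Longrightarrow> ereal b < v \<Longrightarrow> p a (ereal b) = reg p u v"
proof -
  let ?S = "{p a (ereal b) | a b. u < a \<and> a < b \<and> ereal b < v}"
  obtain m where m: "\<And>u v. ereal u < v \<Longrightarrow> m \<le> p u v" using lower_bound by blast
  obtain b where b: "ereal u < ereal b" "ereal b < v" using ereal_dense2[OF uv] by blast
  obtain a where a: "u < a" "a < b" using dense b(1) by auto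
  have "p a b \<in> ?S" using a b by auto
  moreover have "\<forall>s\<in>?S. m \<le> s" using m by auto
  ultimately obtain k where k: "k \<in> ?S" "\<And>s. s \<in> ?S \<Longrightarrow> k \<le> s"
    using int_set_has_least[of _ ?S m] by meson
  then have kR: "reg p u v = k" unfolding reg_def by (intro cInf_eq_minimum) auto
  from k obtain a0 b0 where 0: "k = p a0 (ereal b0)" "u < a0" "a0 < b0" "ereal b0 < v" by auto
  show ?thesis
  proof (rule that[OF 0(2-4)])
    fix a b assume ab: "u < a" "a \<le> a0" "b0 \<le> b" "ereal b < v"
    have "p a b \<le> p a0 b" using ab 0 by (intro mono_u) auto
    also have "\<dots> \<le> k" unfolding 0(1) using ab 0 by (intro anti_v) auto
    finally have "p a b \<le> k" .
    moreover have "k \<le> p a b" using ab 0 by (intro k(2)) force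
    ultimately show "p a b = reg p u v" using kR by simp
  qed
qed

lemma reg_le: "u < a \<Longrightarrow> a < b \<Longrightarrow> ereal b < v \<Longrightarrow> reg p u v \<le> p a (ereal b)"
proof -
  assume ab: "u < a" "a < b" "ereal b < v"
  obtain m where m: "\<And>u v. ereal u < v \<Longrightarrow> m \<le> p u v" using lower_bound by blast
  show ?thesis unfolding reg_def
    using m ab by (intro cInf_lower bdd_belowI[of _ m]) auto
qed

lemma le_reg:
  assumes "ereal u < v" shows "p u v \<le> reg p u v"
proof -
  obtain a b where ab: "u < a" "a < b" "ereal b < v" "p a (ereal b) = reg p u v"
    using reg_attained[OF assms] by (metis order_refl)
  have av: "ereal a < v" using ab(2,3) by (meson ereal_less_eq(3) less_imp_le order_le_less_trans)
  have "p u v \<le> p a v" using ab av by (intro mono_u) auto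
  also have "\<dots> \<le> p a b" using ab by (intro anti_v) auto
  finally show ?thesis using ab by simp
qed

text \<open>Both values are realized by p at one common pair sufficiently close to the corner. Since
  a = u and c = v are included, this is right-continuity in the first and left-continuity in the
  second argument.\<close>

lemma reg_local:
  assumes "ereal u < v"
  obtains a0 b0 where "u < a0" "a0 < b0" "ereal b0 < v"
    "\<And>a c. u \<le> a \<Longrightarrow> a < a0 \<Longrightarrow> ereal b0 < c \<Longrightarrow> c \<le> v \<Longrightarrow> reg p a c = reg p u v"
proof -
  obtain a0 b0 where 0: "u < a0" "a0 < b0" "ereal b0 < v"
    "\<And>a b. u < a \<Longrightarrow> a \<le> a0 \<Longrightarrow> b0 \<le> b \<Longrightarrow> ereal b < v \<Longrightarrow> p a (ereal b) = reg p u v"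
    by (rule reg_attained[OF assms]) blast
  show ?thesis
  proof (rule that[OF 0(1-3)])
    fix a c assume ac: "u \<le> a" "a < a0" "ereal b0 < c" "c \<le> v"
    have "ereal a < c" using ac 0 by (metis ereal_less_eq(3) less_imp_le less_trans order_le_less_trans)
    then obtain a1 b1 where 1: "a < a1" "a1 < b1" "ereal b1 < c"
      "\<And>x b. a < x \<Longrightarrow> x \<le> a1 \<Longrightarrow> b1 \<le> b \<Longrightarrow> ereal b < c \<Longrightarrow> p x (ereal b) = reg p a c"
      using reg_attained by metis
    have B: "ereal (max b0 b1) < c" using ac 1 by (simp add: max_def)
    have "p (min a0 a1) (max b0 b1) = reg p u v" using ac 1 0 B by (intro 0(4)) auto
    moreover have "p (min a0 a1) (max b0 b1) = reg p a c" using ac 1 0 B by (intro 1(4)) auto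
    ultimately show "reg p a c = reg p u v" by simp
  qed
qed

text \<open>The axioms pass to the limit because all four values of \<open>reg p\<close> are
  realized by p at the corners of one common rectangle.\<close>

lemma reg_diff:
  assumes "u1 \<le> u2" "ereal u2 < v1" "v1 \<le> v2"
  shows "reg p u2 v2 - reg p u1 v2 \<le> reg p u2 v1 - reg p u1 v1"
    and "reg p u1 v1 \<le> reg p u2 v1" and "reg p u2 v2 \<le> reg p u2 v1"
proof -
  have *: "\<exists>a0 b0. u < a0 \<and> a0 < b0 \<and> ereal b0 < v \<and>
      (\<forall>a b. u < a \<longrightarrow> a \<le> a0 \<longrightarrow> b0 \<le> b \<longrightarrow> ereal b < v \<longrightarrow> p a (ereal b) = reg p u v)"
    if "ereal u < v" for u v using reg_attained[OF that] by metis
  have lt: "ereal u1 < v1" "ereal u1 < v2" "ereal u2 < v2"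
    using assms by (meson ereal_less_eq(3) order_le_less_trans order_less_le_trans)+
  obtain a11 b11 where 11: "u1 < a11" "a11 < b11" "ereal b11 < v1"
    "\<And>a b. u1 < a \<Longrightarrow> a \<le> a11 \<Longrightarrow> b11 \<le> b \<Longrightarrow> ereal b < v1 \<Longrightarrow> p a (ereal b) = reg p u1 v1"
    using *[OF lt(1)] by metis
  obtain a12 b12 where 12: "u1 < a12" "a12 < b12" "ereal b12 < v2"
    "\<And>a b. u1 < a \<Longrightarrow> a \<le> a12 \<Longrightarrow> b12 \<le> b \<Longrightarrow> ereal b < v2 \<Longrightarrow> p a (ereal b) = reg p u1 v2"
    using *[OF lt(2)] by metis
  obtain a21 b21 where 21: "u2 < a21" "a21 < b21" "ereal b21 < v1"
    "\<And>a b. u2 < a \<Longrightarrow> a \<le> a21 \<Longrightarrow> b21 \<le> b \<Longrightarrow> ereal b < v1 \<Longrightarrow> p a (ereal b) = reg p u2 v1"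
    using *[OF assms(2)] by metis
  obtain a22 b22 where 22: "u2 < a22" "a22 < b22" "ereal b22 < v2"
    "\<And>a b. u2 < a \<Longrightarrow> a \<le> a22 \<Longrightarrow> b22 \<le> b \<Longrightarrow> ereal b < v2 \<Longrightarrow> p a (ereal b) = reg p u2 v2"
    using *[OF lt(3)] by metis
  define a2 where "a2 = min a21 a22"
  define a1 where "a1 = min a2 (min a11 a12)"
  define b1 where "b1 = max b11 b21"
  define b2 where "b2 = max b1 (max b12 b22)"
  have a: "u1 < a1" "a1 \<le> a11" "a1 \<le> a12" "u2 < a2" "a2 \<le> a21" "a2 \<le> a22" "a1 \<le> a2"
    using 11 12 21 22 assms by (auto simp: a1_def a2_def)
  have b: "b11 \<le> b1" "b21 \<le> b1" "b12 \<le> b2" "b22 \<le> b2" "b1 \<le> b2" by (auto simp: b1_def b2_def)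
  have B1: "ereal b1 < v1" using 11 21 by (simp add: b1_def max_def)
  then have B1': "ereal b1 < v2" using assms by simp
  then have B2: "ereal b2 < v2" using 12 22 by (simp add: b2_def max_def)
  have ab: "a2 < b1" using a b 21 by linarith
  have e: "p a1 b1 = reg p u1 v1" "p a1 b2 = reg p u1 v2" "p a2 b1 = reg p u2 v1" "p a2 b2 = reg p u2 v2"
    using a b B1 B2 by (auto intro!: 11(4) 12(4) 21(4) 22(4))
  show "reg p u2 v2 - reg p u1 v2 \<le> reg p u2 v1 - reg p u1 v1"
    using diff[of a1 a2 "ereal b1" "ereal b2"] a b ab by (simp add: e)
  show "reg p u1 v1 \<le> reg p u2 v1"
    using mono_u[of a1 a2 "ereal b1"] a ab by (simp add: e)
  show "reg p u2 v2 \<le> reg p u2 v1"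
    using anti_v[of a2 "ereal b1" "ereal b2"] b ab by (simp add: e)
qed

section \<open>Local constancy of the regularization\<close>

text \<open>By the second axiom, constancy on a horizontal segment at height c propagates to all
heights above c; likewise vertical constancy propagates to the left.\<close>

lemma strip_right:
  assumes "ereal u < c"
  obtains r where "r > 0" "ereal (u + r) < c"
    "\<And>a b. u \<le> a \<Longrightarrow> a \<le> u + r \<Longrightarrow> c \<le> b \<Longrightarrow> reg p a b = reg p u b"
proof -
  obtain a0 b0 where 0: "u < a0" "a0 < b0" "ereal b0 < c"
    "\<And>a d. u \<le> a \<Longrightarrow> a < a0 \<Longrightarrow> ereal b0 < d \<Longrightarrow> d \<le> c \<Longrightarrow> reg p a d = reg p u c"
    by (rule reg_local[OF assms]) blast
  show ?thesis
  proof (rule that[of "(a0 - u) / 2"])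
    show "(a0 - u) / 2 > 0" using 0 by simp
    have "u + (a0 - u) / 2 < b0" using 0 by (simp add: field_simps)
    then have lt: "ereal (u + (a0 - u) / 2) < ereal b0" by simp
    then show lt: "ereal (u + (a0 - u) / 2) < c" using 0(3) by (rule less_trans)
    fix a b assume ab: "u \<le> a" "a \<le> u + (a0 - u) / 2" "c \<le> b"
    have ac: "ereal a < c" using ab lt by (meson ereal_less_eq(3) order_le_less_trans)
    have "reg p a c = reg p u c" using ab 0 by (intro 0(4)) (auto simp: field_simps)
    moreover have "reg p a b - reg p u b \<le> reg p a c - reg p u c"
      using ab ac by (intro reg_diff(1)) auto
    moreover have "reg p u b \<le> reg p a b" using ab ac by (intro reg_diff(2)[of _ _ _ b]) auto
    ultimately show "reg p a b = reg p u b" by simp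
  qed
qed

text \<open>Left of u the values at height c are nondecreasing integers bounded by
  \<open>reg p u c\<close>, so they reach their supremum before u. This left limit may differ from
  the value at u, hence the reference abscissa \<open>u - r\<close>.\<close>

lemma strip_left:
  assumes "ereal u < c"
  obtains r where "r > 0"
    "\<And>a b. u - r \<le> a \<Longrightarrow> a < u \<Longrightarrow> c \<le> b \<Longrightarrow> reg p a b = reg p (u - r) b"
proof -
  let ?S = "(\<lambda>a. reg p a c) ` {..<u}"
  have lt: "ereal a < c" if "a \<le> u" for a
    using that assms by (meson ereal_less_eq(3) order_le_less_trans)
  have *: "\<forall>s\<in>?S. s \<le> reg p u c" using assms by (auto intro!: reg_diff(2)[of _ _ _ c])
  have "reg p (u - 1) c \<in> ?S" by auto
  from int_set_has_greatest[OF this *] obtain k where k: "k \<in> ?S" "\<forall>s\<in>?S. s \<le> k" ..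
  then obtain a0 where a0: "a0 < u" "k = reg p a0 c" by auto
  show ?thesis
  proof (rule that[of "u - a0"])
    show "u - a0 > 0" using a0 by simp
    fix a b assume ab: "u - (u - a0) \<le> a" "a < u" "c \<le> b"
    have ac: "ereal a < c" using ab lt by simp
    have "reg p a c \<le> reg p a0 c" using k(2) ab a0 by auto
    moreover have "reg p a b - reg p a0 b \<le> reg p a c - reg p a0 c"
      using ab ac by (intro reg_diff(1)) auto
    moreover have "ereal a < b" using ac ab by simp
    then have "reg p a0 b \<le> reg p a b" using ab by (intro reg_diff(2)[of _ _ _ b]) auto
    ultimately show "reg p a b = reg p (u - (u - a0)) b" by simp
  qed
qed

lemma strip_below:
  assumes "ereal u < v"
  obtains d where "u < d" "ereal d < v"
    "\<And>a b. a \<le> u \<Longrightarrow> ereal d \<le> b \<Longrightarrow> b \<le> v \<Longrightarrow> reg p a b = reg p a v"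
proof -
  obtain a0 b0 where 0: "u < a0" "a0 < b0" "ereal b0 < v"
    "\<And>a d. u \<le> a \<Longrightarrow> a < a0 \<Longrightarrow> ereal b0 < d \<Longrightarrow> d \<le> v \<Longrightarrow> reg p a d = reg p u v"
    by (rule reg_local[OF assms]) blast
  obtain d where d: "ereal b0 < ereal d" "ereal d < v" using ereal_dense2[OF 0(3)] by blast
  show ?thesis
  proof (rule that[of d])
    show "u < d" "ereal d < v" using d 0 by auto
    fix a b assume ab: "a \<le> u" "ereal d \<le> b" "b \<le> v"
    have ub: "ereal u < b" using ab \<open>u < d\<close> by (meson less_ereal.simps(1) order_less_le_trans)
    then have "ereal a < b" using ab by (meson ereal_less_eq(3) order_le_less_trans)
    have "ereal b0 < b" using d(1) ab(2) by (rule order_less_le_trans)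
    then have "reg p u b = reg p u v" using 0 ab by (intro 0(4)) auto
    moreover have "reg p u v - reg p a v \<le> reg p u b - reg p a b"
      using ab ub by (intro reg_diff(1)) auto
    moreover have "reg p a v \<le> reg p a b" using ab \<open>ereal a < b\<close> by (intro reg_diff(3)[of a]) auto
    ultimately show "reg p a b = reg p a v" by simp
  qed
qed

text \<open>Counterpart of \<open>strip_left\<close>: as b decreases to v, the integers
  \<open>reg p u b\<close> grow and are bounded by \<open>reg p u v\<close>, so they stabilize,
  possibly at a value below it.\<close>

lemma strip_above:
  assumes "u < v"
  obtains d where "v < d"
    "\<And>a b. a \<le> u \<Longrightarrow> ereal v < b \<Longrightarrow> b \<le> ereal d \<Longrightarrow> reg p a b = reg p a d"
proof -
  let ?S = "(\<lambda>b. reg p u (ereal b)) ` {v<..}"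
  have *: "\<forall>s\<in>?S. s \<le> reg p u v"
    using assms by (auto intro!: reg_diff(3)[of u])
  have "reg p u (v + 1) \<in> ?S" by auto
  from int_set_has_greatest[OF this *] obtain k where k: "k \<in> ?S" "\<forall>s\<in>?S. s \<le> k" ..
  then obtain d where d: "v < d" "k = reg p u d" by auto
  show ?thesis
  proof (rule that[OF d(1)])
    fix a b assume ab: "a \<le> u" "ereal v < b" "b \<le> ereal d"
    then obtain b' where b': "b = ereal b'" "v < b'" "b' \<le> d" by (cases b) auto
    have "reg p u b \<le> reg p u d" using k(2) b' d by auto
    moreover have "reg p u d - reg p a d \<le> reg p u b - reg p a b"
      using ab b' assms by (intro reg_diff(1)) auto
    moreover have "reg p a d \<le> reg p a b" using ab b' assms by (intro reg_diff(3)[of a]) auto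
    ultimately show "reg p a b = reg p a d" by simp
  qed
qed

section \<open>Multiplicities as alternating sums of quadrant values\<close>

lemma box_mono:
  assumes "a1 \<le> a2" "a2 \<le> a3" "a3 \<le> a4" "ereal a4 < c1" "c1 \<le> c2" "c2 \<le> c3" "c3 \<le> c4"
  shows "p a3 c2 - p a2 c2 - p a3 c3 + p a2 c3 \<le> p a4 c1 - p a1 c1 - p a4 c4 + p a1 c4"
proof -
  have lt: "ereal a < c1" if "a \<le> a4" for a
    using that assms(4) by (meson ereal_less_eq(3) order_le_less_trans)
  have "ereal a3 < c2" "ereal a3 < c3"
    using lt[of a3] assms by (auto intro: order_less_le_trans)
  \<comment> \<open>The outer rectangle minus the inner one splits into four rectangles: right,
    below, above and left of the inner one. Each inequality says that one of them has nonnegative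
    mass.\<close>
  then have "p a4 c4 - p a3 c4 \<le> p a4 c1 - p a3 c1" "p a3 c2 - p a2 c2 \<le> p a3 c1 - p a2 c1"
    "p a3 c4 - p a2 c4 \<le> p a3 c3 - p a2 c3" "p a2 c4 - p a1 c4 \<le> p a2 c1 - p a1 c1"
    using lt assms by (auto intro!: diff)
  then show ?thesis by linarith
qed

text \<open>Wherever \<open>reg p\<close> is constant on a small neighbourhood, both bounds coincide
  and p equals \<open>reg p\<close>; this is how the infimum over values of p in
  \<open>multiplicity\<close> is evaluated.\<close>

lemma p_between:
  assumes "\<theta> > 0" "a < b"
  shows "reg p (a - \<theta>) (ereal (b + \<theta>)) \<le> p a (ereal b)" "p a (ereal b) \<le> reg p a (ereal b)"
  using assms by (auto intro: reg_le le_reg)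

text \<open>\<alpha>, \<beta>, \<gamma>, \<delta> are the values right-below, left-below,
  right-above and left-above of (u,v). Small boxes all have the mass \<alpha> - \<beta> - \<gamma> +
  \<delta>, and by \<open>box_mono\<close> larger ones have no less, so this is the minimum in the
  definition.\<close>

lemma corner_finite:
  assumes "u < v"
  shows "\<exists>r \<alpha> \<beta> \<gamma> \<delta>. r > 0 \<and> u + r < v - r \<and>
    (\<forall>a b. u \<le> a \<longrightarrow> a \<le> u + r \<longrightarrow> v - r \<le> b \<longrightarrow> b \<le> v \<longrightarrow> reg p a (ereal b) = \<alpha>) \<and>
    (\<forall>a b. u - r \<le> a \<longrightarrow> a < u \<longrightarrow> v - r \<le> b \<longrightarrow> b \<le> v \<longrightarrow> reg p a (ereal b) = \<beta>) \<and>
    (\<forall>a b. u \<le> a \<longrightarrow> a \<le> u + r \<longrightarrow> v < b \<longrightarrow> b \<le> v + r \<longrightarrow> reg p a (ereal b) = \<gamma>) \<and>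
    (\<forall>a b. u - r \<le> a \<longrightarrow> a < u \<longrightarrow> v < b \<longrightarrow> b \<le> v + r \<longrightarrow> reg p a (ereal b) = \<delta>) \<and>
    int (multiplicity p u (ereal v)) = \<alpha> - \<beta> - \<gamma> + \<delta>"
proof -
  obtain u1 where u1: "u < u1" "u1 < v" using dense assms by blast
  \<comment> \<open>Horizontal strips based at a height c below v hold on both sides of v at
    once.\<close>
  then obtain c where c: "u1 < c" "c < v" using dense by blast
  obtain r1 where r1: "r1 > 0" "ereal (u + r1) < ereal c"
    "\<And>a b. u \<le> a \<Longrightarrow> a \<le> u + r1 \<Longrightarrow> ereal c \<le> b \<Longrightarrow> reg p a b = reg p u b"
    using strip_right[of u "ereal c"] u1 c by auto
  obtain r2 where r2: "r2 > 0"
    "\<And>a b. u - r2 \<le> a \<Longrightarrow> a < u \<Longrightarrow> ereal c \<le> b \<Longrightarrow> reg p a b = reg p (u - r2) b"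
    using strip_left[of u "ereal c"] u1 c by auto
  obtain d1 where d1: "u1 < d1" "d1 < v"
    "\<And>a b. a \<le> u1 \<Longrightarrow> ereal d1 \<le> b \<Longrightarrow> b \<le> ereal v \<Longrightarrow> reg p a b = reg p a v"
    using strip_below[of u1 v] u1 by auto
  obtain d2 where d2: "v < d2"
    "\<And>a b. a \<le> u1 \<Longrightarrow> ereal v < b \<Longrightarrow> b \<le> ereal d2 \<Longrightarrow> reg p a b = reg p a d2"
    using strip_above[of u1 v] u1 by auto
  define S where "S = {r1, r2, v - d1, d2 - v, v - c, (v - u) / 3, u1 - u}"
  define r where "r = Min S"
  have S: "finite S" "S \<noteq> {}" "\<forall>x\<in>S. 0 < x"
    using r1(1) r2(1) d1(2) d2(1) c u1 by (auto simp: S_def)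
  have "r > 0" unfolding r_def using S by (subst Min_gr_iff) auto
  moreover have "\<forall>x\<in>S. r \<le> x" unfolding r_def using S by auto
  ultimately have r: "r > 0" "r \<le> r1" "r \<le> r2" "r \<le> v - d1" "r \<le> d2 - v" "r \<le> v - c"
    "r \<le> (v - u) / 3" "r \<le> u1 - u"
    unfolding S_def by blast+
  define \<alpha> \<beta> \<gamma> \<delta> where "\<alpha> = reg p u v" and "\<beta> = reg p (u - r2) v" and "\<gamma> = reg p u d2"
    and "\<delta> = reg p (u - r2) d2"
  have R: "\<And>a b. u \<le> a \<Longrightarrow> a \<le> u + r \<Longrightarrow> v - r \<le> b \<Longrightarrow> b \<le> v \<Longrightarrow> reg p a (ereal b) = \<alpha>"
    "\<And>a b. u - r \<le> a \<Longrightarrow> a < u \<Longrightarrow> v - r \<le> b \<Longrightarrow> b \<le> v \<Longrightarrow> reg p a (ereal b) = \<beta>"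
    "\<And>a b. u \<le> a \<Longrightarrow> a \<le> u + r \<Longrightarrow> v < b \<Longrightarrow> b \<le> v + r \<Longrightarrow> reg p a (ereal b) = \<gamma>"
    "\<And>a b. u - r \<le> a \<Longrightarrow> a < u \<Longrightarrow> v < b \<Longrightarrow> b \<le> v + r \<Longrightarrow> reg p a (ereal b) = \<delta>"
  proof -
    fix a b
    show "reg p a (ereal b) = \<alpha>" if "u \<le> a" "a \<le> u + r" "v - r \<le> b" "b \<le> v"
      using r1(3)[of a b] d1(3)[of u b] that r u1 by (simp add: \<alpha>_def)
    show "reg p a (ereal b) = \<beta>" if "u - r \<le> a" "a < u" "v - r \<le> b" "b \<le> v"
      using r2(2)[of a b] d1(3)[of "u - r2" b] that r u1 r2(1) by (simp add: \<beta>_def)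
    show "reg p a (ereal b) = \<gamma>" if "u \<le> a" "a \<le> u + r" "v < b" "b \<le> v + r"
      using r1(3)[of a b] d2(2)[of u b] that r u1 c by (simp add: \<gamma>_def)
    show "reg p a (ereal b) = \<delta>" if "u - r \<le> a" "a < u" "v < b" "b \<le> v + r"
      using r2(2)[of a b] d2(2)[of "u - r2" b] that r u1 r2(1) c by (simp add: \<delta>_def)
  qed
  have uvr: "u + r < v - r" using r(1,7) by (simp add: field_simps)
  let ?box = "\<lambda>\<epsilon>. p (u + \<epsilon>) (ereal (v - \<epsilon>)) - p (u - \<epsilon>) (ereal (v - \<epsilon>))
                 - p (u + \<epsilon>) (ereal (v + \<epsilon>)) + p (u - \<epsilon>) (ereal (v + \<epsilon>))"
  define n where "n = \<alpha> - \<beta> - \<gamma> + \<delta>"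
  \<comment> \<open>The bound \<open>r / 2\<close> leaves room for the further shift by
    \<open>\<epsilon> / 2\<close> in \<open>p_between\<close>.\<close>
  have box: "?box \<epsilon> = n" if e: "0 < \<epsilon>" "\<epsilon> \<le> r / 2" for \<epsilon>
  proof -
    have "p (u + \<epsilon>) (ereal (v - \<epsilon>)) = \<alpha>"
      using p_between[of "\<epsilon> / 2" "u + \<epsilon>" "v - \<epsilon>"] R(1)[of "u + \<epsilon>" "v - \<epsilon>"]
        R(1)[of "u + \<epsilon> - \<epsilon> / 2" "v - \<epsilon> + \<epsilon> / 2"] e uvr by linarith
    moreover have "p (u - \<epsilon>) (ereal (v - \<epsilon>)) = \<beta>"
      using p_between[of "\<epsilon> / 2" "u - \<epsilon>" "v - \<epsilon>"] R(2)[of "u - \<epsilon>" "v - \<epsilon>"]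
        R(2)[of "u - \<epsilon> - \<epsilon> / 2" "v - \<epsilon> + \<epsilon> / 2"] e uvr by linarith
    moreover have "p (u + \<epsilon>) (ereal (v + \<epsilon>)) = \<gamma>"
      using p_between[of "\<epsilon> / 2" "u + \<epsilon>" "v + \<epsilon>"] R(3)[of "u + \<epsilon>" "v + \<epsilon>"]
        R(3)[of "u + \<epsilon> - \<epsilon> / 2" "v + \<epsilon> + \<epsilon> / 2"] e uvr by linarith
    moreover have "p (u - \<epsilon>) (ereal (v + \<epsilon>)) = \<delta>"
      using p_between[of "\<epsilon> / 2" "u - \<epsilon>" "v + \<epsilon>"] R(4)[of "u - \<epsilon>" "v + \<epsilon>"]
        R(4)[of "u - \<epsilon> - \<epsilon> / 2" "v + \<epsilon> + \<epsilon> / 2"] e uvr by linarith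
    ultimately show ?thesis by (simp add: n_def)
  qed
  let ?S = "{?box \<epsilon> | \<epsilon>. \<epsilon> > 0 \<and> u + \<epsilon> < v - \<epsilon>}"
  have "Inf ?S = n"
  proof (rule cInf_eq_minimum)
    have "u + r / 2 < v - r / 2" using uvr r by simp
    then show "n \<in> ?S" using box[of "r / 2"] r by fastforce
    fix s assume "s \<in> ?S"
    then obtain \<epsilon> where e: "s = ?box \<epsilon>" "\<epsilon> > 0" "u + \<epsilon> < v - \<epsilon>" by blast
    let ?e = "min \<epsilon> (r / 2)"
    have "n = ?box ?e" using box[of ?e] e r by simp
    also have "\<dots> \<le> ?box \<epsilon>" using e r by (intro box_mono) auto
    finally show "n \<le> s" using e by simp
  qed
  moreover have "n \<ge> 0"
  proof -
    have "0 \<le> ?box (r / 2)"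
      using diff[of "u - r / 2" "u + r / 2" "ereal (v - r / 2)" "ereal (v + r / 2)"] r uvr by simp
    then show ?thesis using box[of "r / 2"] r by simp
  qed
  ultimately have m: "int (multiplicity p u (ereal v)) = \<alpha> - \<beta> - \<gamma> + \<delta>"
    by (simp add: multiplicity_def n_def)
  show ?thesis
    by (rule exI[of _ r], rule exI[of _ \<alpha>], rule exI[of _ \<beta>], rule exI[of _ \<gamma>], rule exI[of _ \<delta>])
      (intro conjI allI impI r(1) uvr m R; assumption)
qed

text \<open>Above some height C nothing changes any more, so only two regions, right and left of u,
  remain. Their values are limits over finite heights, which is what 1 / \<epsilon> in the
  definition sees.\<close>

lemma corner_infinite:
  "\<exists>r C \<alpha> \<beta>. r > 0 \<and> u + r < C \<and>
    (\<forall>a b. u \<le> a \<longrightarrow> a \<le> u + r \<longrightarrow> ereal C \<le> b \<longrightarrow> reg p a b = \<alpha>) \<and>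
    (\<forall>a b. u - r \<le> a \<longrightarrow> a < u \<longrightarrow> ereal C \<le> b \<longrightarrow> reg p a b = \<beta>) \<and>
    int (multiplicity p u \<infinity>) = \<alpha> - \<beta>"
proof -
  obtain C where C: "u + 1 < C"
    "\<And>a b. a \<le> u + 1 \<Longrightarrow> ereal C \<le> b \<Longrightarrow> b \<le> \<infinity> \<Longrightarrow> reg p a b = reg p a \<infinity>"
    using strip_below[of "u + 1" \<infinity>] by auto
  obtain r1 where r1: "r1 > 0" "ereal (u + r1) < ereal C"
    "\<And>a b. u \<le> a \<Longrightarrow> a \<le> u + r1 \<Longrightarrow> ereal C \<le> b \<Longrightarrow> reg p a b = reg p u b"
    using strip_right[of u "ereal C"] C(1) by auto
  obtain r2 where r2: "r2 > 0"
    "\<And>a b. u - r2 \<le> a \<Longrightarrow> a < u \<Longrightarrow> ereal C \<le> b \<Longrightarrow> reg p a b = reg p (u - r2) b"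
    using strip_left[of u "ereal C"] C(1) by auto
  \<comment> \<open>The bound 1 keeps u + r below C; the bound 1 / (1 + |C|) forces 1 / \<epsilon>
    above C for every \<epsilon> up to r.\<close>
  define r where "r = min r1 (min r2 (min 1 (1 / (1 + \<bar>C\<bar>))))"
  have r: "r > 0" "r \<le> r1" "r \<le> r2" "r \<le> 1" "r \<le> 1 / (1 + \<bar>C\<bar>)"
    using r1(1) r2(1) by (simp_all add: r_def min_le_iff_disj add_pos_nonneg)
  define \<alpha> \<beta> where "\<alpha> = reg p u \<infinity>" and "\<beta> = reg p (u - r2) \<infinity>"
  have R: "\<And>a b. u \<le> a \<Longrightarrow> a \<le> u + r \<Longrightarrow> ereal C \<le> b \<Longrightarrow> reg p a b = \<alpha>"
    "\<And>a b. u - r \<le> a \<Longrightarrow> a < u \<Longrightarrow> ereal C \<le> b \<Longrightarrow> reg p a b = \<beta>"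
  proof -
    fix a b
    show "reg p a b = \<alpha>" if "u \<le> a" "a \<le> u + r" "ereal C \<le> b"
      using r1(3)[of a b] C(2)[of u b] that r by (simp add: \<alpha>_def)
    show "reg p a b = \<beta>" if "u - r \<le> a" "a < u" "ereal C \<le> b"
      using r2(2)[of a b] C(2)[of "u - r2" b] that r r2(1) by (simp add: \<beta>_def)
  qed
  let ?box = "\<lambda>\<epsilon>. p (u + \<epsilon>) (ereal (1 / \<epsilon>)) - p (u - \<epsilon>) (ereal (1 / \<epsilon>))"
  have big: "C < 1 / \<epsilon>" if "0 < \<epsilon>" "\<epsilon> \<le> r / 2" for \<epsilon>
  proof -
    have "\<epsilon> \<le> 1 / (1 + \<bar>C\<bar>)" using that r by linarith
    then have "1 + \<bar>C\<bar> \<le> 1 / \<epsilon>" using that by (simp add: field_simps)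
    then show ?thesis by linarith
  qed
  have box: "?box \<epsilon> = \<alpha> - \<beta>" if e: "0 < \<epsilon>" "\<epsilon> \<le> r / 2" for \<epsilon>
  proof -
    define b where "b = 1 / \<epsilon>"
    have b: "C < b" using big[OF e] by (simp add: b_def)
    then have lt: "u + \<epsilon> < b" "u - \<epsilon> < b" using C(1) r(4) e by linarith+
    have "p (u + \<epsilon>) (ereal b) = \<alpha>"
      using p_between[of "\<epsilon> / 2" "u + \<epsilon>" b] R(1)[of "u + \<epsilon>" "ereal b"]
        R(1)[of "u + \<epsilon> - \<epsilon> / 2" "ereal (b + \<epsilon> / 2)"] e b lt by force
    moreover have "p (u - \<epsilon>) (ereal b) = \<beta>"
      using p_between[of "\<epsilon> / 2" "u - \<epsilon>" b] R(2)[of "u - \<epsilon>" "ereal b"]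
        R(2)[of "u - \<epsilon> - \<epsilon> / 2" "ereal (b + \<epsilon> / 2)"] e b lt by force
    ultimately show ?thesis by (simp add: b_def)
  qed
  let ?S = "{?box \<epsilon> | \<epsilon>. \<epsilon> > 0 \<and> u + \<epsilon> < 1 / \<epsilon>}"
  have "Inf ?S = \<alpha> - \<beta>"
  proof (rule cInf_eq_minimum)
    have "u + r / 2 < 1 / (r / 2)" using big[of "r / 2"] r C(1) by linarith
    moreover have "\<alpha> - \<beta> = ?box (r / 2)" using box[of "r / 2"] r by simp
    moreover have "r / 2 > 0" using r by simp
    ultimately show "\<alpha> - \<beta> \<in> ?S" by blast
    fix s assume "s \<in> ?S"
    then obtain \<epsilon> where e: "s = ?box \<epsilon>" "\<epsilon> > 0" "u + \<epsilon> < 1 / \<epsilon>" by blast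
    let ?e = "min \<epsilon> (r / 2)"
    have e': "0 < ?e" "?e \<le> \<epsilon>" using e r by auto
    \<comment> \<open>Shrinking \<epsilon> also raises the height; the second axiom shows that this
      lowers the difference, and monotonicity in u handles the narrower interval.\<close>
    then have le: "1 / \<epsilon> \<le> 1 / ?e" by (intro divide_left_mono) auto
    have lt: "u + ?e < 1 / \<epsilon>" using e e' by linarith
    have "\<alpha> - \<beta> = ?box ?e" using box[of ?e] e r by simp
    also have "\<dots> \<le> p (u + ?e) (ereal (1 / \<epsilon>)) - p (u - ?e) (ereal (1 / \<epsilon>))"
      using e' le lt by (intro diff) auto
    also have "\<dots> \<le> ?box \<epsilon>"
      using mono_u[of "u + ?e" "u + \<epsilon>" "ereal (1 / \<epsilon>)"] mono_u[of "u - \<epsilon>" "u - ?e" "ereal (1 / \<epsilon>)"]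
        e e' by simp
    finally show "\<alpha> - \<beta> \<le> s" using e by simp
  qed
  moreover have "\<alpha> - \<beta> \<ge> 0"
    using reg_diff(2)[of "u - r2" u \<infinity> \<infinity>] r2(1) by (simp add: \<alpha>_def \<beta>_def)
  ultimately have m: "int (multiplicity p u \<infinity>) = \<alpha> - \<beta>" by (simp add: multiplicity_def)
  have uC: "u + r < C" using C(1) r(4) by linarith
  show ?thesis
    by (rule exI[of _ r], rule exI[of _ C], rule exI[of _ \<alpha>], rule exI[of _ \<beta>])
      (intro conjI allI impI r(1) uC m R; assumption)
qed

end

section \<open>Counting cornerpoints\<close>

text \<open>Each \<open>x\<close> has a neighbourhood in which \<open>g\<close> is constant up to x
  and constant after it, so only x itself carries elements of \<open>M\<close> there; bisection adds
  up the jumps. The jump at x happens just after x, whence the interval {lo..<hi}.\<close>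

lemma jump_count:
  fixes g :: "real \<Rightarrow> int" and M :: "real \<Rightarrow> 'b set"
  assumes "lo \<le> hi"
    and jump: "\<And>x. lo \<le> x \<Longrightarrow> x \<le> hi \<Longrightarrow> \<exists>\<rho>>0. \<exists>g'. (\<forall>y. lo \<le> y \<longrightarrow> x - \<rho> \<le> y \<longrightarrow> y \<le> x \<longrightarrow> g y = g x) \<and>
      (\<forall>y. x < y \<longrightarrow> y \<le> x + \<rho> \<longrightarrow> g y = g') \<and> finite (M x) \<and> int (card (M x)) = g x - g'"
  shows "finite (Sigma {lo..<hi} M) \<and> int (card (Sigma {lo..<hi} M)) = g lo - g hi"
proof -
  define P where "P x y \<longleftrightarrow> (lo \<le> x \<longrightarrow> x \<le> y \<longrightarrow> y \<le> hi \<longrightarrow>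
    finite (Sigma {x..<y} M) \<and> int (card (Sigma {x..<y} M)) = g x - g y)" for x y
  have "P lo hi"
    using assms(1)
  proof (induction rule: Bolzano)
    case (trans a b c)
    show ?case
      unfolding P_def
    proof (intro impI)
      assume "lo \<le> a" "a \<le> c" "c \<le> hi"
      then have 1: "finite (Sigma {a..<b} M)" "int (card (Sigma {a..<b} M)) = g a - g b"
        "finite (Sigma {b..<c} M)" "int (card (Sigma {b..<c} M)) = g b - g c"
        using trans by (auto simp: P_def)
      have "Sigma {a..<c} M = Sigma {a..<b} M \<union> Sigma {b..<c} M" using trans by auto
      moreover have "card (Sigma {a..<b} M \<union> Sigma {b..<c} M) = card (Sigma {a..<b} M) + card (Sigma {b..<c} M)"
        using 1 by (intro card_Un_disjoint) auto
      ultimately show "finite (Sigma {a..<c} M) \<and> int (card (Sigma {a..<c} M)) = g a - g c"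
        using 1 by simp
    qed
  next
    case (local x)
    obtain \<rho> g' where \<rho>: "\<rho> > 0" "\<And>y. lo \<le> y \<Longrightarrow> x - \<rho> \<le> y \<Longrightarrow> y \<le> x \<Longrightarrow> g y = g x"
      "\<And>y. x < y \<Longrightarrow> y \<le> x + \<rho> \<Longrightarrow> g y = g'" "finite (M x)" "int (card (M x)) = g x - g'"
      using jump[OF local] by blast
    have empty: "M v = {}" if v: "lo \<le> v" "v \<le> hi" "x - \<rho> \<le> v" "v < x + \<rho>" "v \<noteq> x" for v
    proof -
      obtain \<sigma> h' where \<sigma>: "\<sigma> > 0" 
        "\<And>y. v < y \<Longrightarrow> y \<le> v + \<sigma> \<Longrightarrow> g y = h'" "finite (M v)" "int (card (M v)) = g v - h'"
        using jump[OF v(1,2)] by blast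
      \<comment> \<open>\<open>y\<close> lies just after v on the same side of x, so g does not
        change from v to y and its jump at v vanishes.\<close>
      obtain y where y: "v < y" "y \<le> v + \<sigma>" "y < x + \<rho>" "v < x \<longrightarrow> y < x"
      proof (cases "v < x")
        case True
        then show ?thesis using that[of "min (v + \<sigma>) ((v + x) / 2)"] \<sigma>(1) \<rho>(1)
          by (auto simp: min_def field_simps)
      next
        case False
        then show ?thesis using that[of "min (v + \<sigma>) ((v + x + \<rho>) / 2)"] \<sigma>(1) \<rho>(1) v
          by (auto simp: min_def field_simps)
      qed
      have "g v = g y"
      proof (cases "v < x")
        case True
        then show ?thesis using \<rho>(2)[of v] \<rho>(2)[of y] v y by simp
      next
        case False
        then show ?thesis using \<rho>(3)[of v] \<rho>(3)[of y] v y by simp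
      qed
      then show ?thesis using \<sigma>(2)[of y] \<sigma>(3,4) y by simp
    qed
    show ?case
    proof (intro exI[of _ \<rho>] conjI allI impI)
      fix a b assume ab: "a \<le> x \<and> x \<le> b \<and> b - a < \<rho>"
      show "P a b"
        unfolding P_def
      proof (intro impI)
        assume b: "lo \<le> a" "a \<le> b" "b \<le> hi"
        show "finite (Sigma {a..<b} M) \<and> int (card (Sigma {a..<b} M)) = g a - g b"
        proof (cases "x < b")
          case True
          have "Sigma {a..<b} M = {x} \<times> M x"
          proof (intro equalityI subsetI)
            fix z assume z: "z \<in> Sigma {a..<b} M"
            then have "M (fst z) \<noteq> {}" "fst z \<in> {a..<b}" by auto
            then have "fst z = x" using empty[of "fst z"] ab b \<rho>(1) by (cases "fst z = x") auto
            then show "z \<in> {x} \<times> M x" using z by auto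
          qed (use ab True in auto)
          moreover have "g a = g x" using \<rho>(2)[of a] ab b by simp
          moreover have "g b = g'" using \<rho>(3)[of b] ab b True by simp
          ultimately show ?thesis using \<rho>(4,5) by (simp add: card_cartesian_product)
        next
          case False
          have "Sigma {a..<b} M = {}"
          proof (rule equals0I)
            fix z assume z: "z \<in> Sigma {a..<b} M"
            then have "M (fst z) \<noteq> {}" "fst z \<in> {a..<b}" by auto
            then show False using empty[of "fst z"] ab b \<rho>(1) False by auto
          qed
          moreover have "g a = g x" using ab b False by (intro \<rho>(2)) auto
          moreover have "g b = g x" using ab b False \<rho>(1) by (intro \<rho>(2)) auto
          ultimately show ?thesis by simp
        qed
      qed
    qed (use \<rho> in auto)
  qed
  then show ?thesis using assms(1) by (simp add: P_def)
qed

context cpf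
begin

text \<open>\<open>W\<close> is the mass of the column u at heights from y upwards; passing v
  removes exactly the labels at v.\<close>

lemma jump_at:
  assumes uc: "ereal u < c" and vc: "c \<le> ereal v" and r: "r > 0"
    and strip: "\<And>a b. u - r \<le> a \<Longrightarrow> a < u \<Longrightarrow> c \<le> b \<Longrightarrow> reg p a b = reg p (u - r) b"
  defines "W \<equiv> \<lambda>y. reg p u y - reg p (u - r) y"
  shows "\<exists>\<rho>>0. \<exists>w. (\<forall>y. c \<le> ereal y \<longrightarrow> v - \<rho> \<le> y \<longrightarrow> y \<le> v \<longrightarrow> W y = W v) \<and>
    (\<forall>y. v < y \<longrightarrow> y \<le> v + \<rho> \<longrightarrow> W y = w) \<and> int (multiplicity p u v) = W v - w"
proof -
  have "ereal u < ereal v" using uc vc by (rule order_less_le_trans)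
  then have uv: "u < v" by simp
  obtain s \<alpha> \<beta> \<gamma> \<delta> where s: "s > 0" "u + s < v - s"
    "\<forall>a b. u \<le> a \<longrightarrow> a \<le> u + s \<longrightarrow> v - s \<le> b \<longrightarrow> b \<le> v \<longrightarrow> reg p a (ereal b) = \<alpha>"
    "\<forall>a b. u - s \<le> a \<longrightarrow> a < u \<longrightarrow> v - s \<le> b \<longrightarrow> b \<le> v \<longrightarrow> reg p a (ereal b) = \<beta>"
    "\<forall>a b. u \<le> a \<longrightarrow> a \<le> u + s \<longrightarrow> v < b \<longrightarrow> b \<le> v + s \<longrightarrow> reg p a (ereal b) = \<gamma>"
    "\<forall>a b. u - s \<le> a \<longrightarrow> a < u \<longrightarrow> v < b \<longrightarrow> b \<le> v + s \<longrightarrow> reg p a (ereal b) = \<delta>"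
    "int (multiplicity p u (ereal v)) = \<alpha> - \<beta> - \<gamma> + \<delta>"
    using corner_finite[OF uv] by (elim exE conjE)
  \<comment> \<open>An abscissa left of u inside both windows, where the strip of width r and the
    square of size s can be compared.\<close>
  define a where "a = max (u - r) (u - s)"
  have a: "u - r \<le> a" "u - s \<le> a" "a < u" using r s(1) by (auto simp: a_def)
  have le: "reg p u y = \<alpha>" "reg p (u - r) y = \<beta>" if "c \<le> ereal y" "v - s \<le> y" "y \<le> v" for y
    using s(3)[rule_format, of u y] s(4)[rule_format, of a y] strip[of a y] a that s(1) by auto
  have gt: "reg p u y = \<gamma>" "reg p (u - r) y = \<delta>" if "v < y" "y \<le> v + s" for y
  proof -
    have "c \<le> ereal y" using vc that by (meson ereal_less_eq(3) less_imp_le order_trans)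
    then show "reg p u y = \<gamma>" "reg p (u - r) y = \<delta>"
      using s(5)[rule_format, of u y] s(6)[rule_format, of a y] strip[of a y] a that s(1) by auto
  qed
  show ?thesis
  proof (intro exI[of _ s] conjI exI[of _ "\<gamma> - \<delta>"] allI impI)
    have v: "W v = \<alpha> - \<beta>" using le[of v] vc s(1) by (simp add: W_def)
    then show "int (multiplicity p u v) = W v - (\<gamma> - \<delta>)" using s(7) by simp
    show "W y = W v" if "c \<le> ereal y" "v - s \<le> y" "y \<le> v" for y
      using le[OF that] v by (simp add: W_def)
    show "W y = \<gamma> - \<delta>" if "v < y" "y \<le> v + s" for y using gt[OF that] by (simp add: W_def)
  qed (rule s(1))
qed

text \<open>The finite heights are summed by \<open>jump_count\<close> up to a height d beyond which
  \<open>W\<close> is constant; the remaining mass \<open>W d\<close> = \<open>W \<infinity>\<close>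
  is the multiplicity at infinity.\<close>

lemma column_count:
  assumes uc: "ereal u < c" and r: "r > 0"
    and strip: "\<And>a b. u - r \<le> a \<Longrightarrow> a < u \<Longrightarrow> c \<le> b \<Longrightarrow> reg p a b = reg p (u - r) b"
  shows "finite {(v, k). c \<le> v \<and> k < multiplicity p u v}" (is "finite ?K")
    and "int (card {(v, k). c \<le> v \<and> k < multiplicity p u v}) = reg p u c - reg p (u - r) c"
proof -
  define W where "W y = reg p u y - reg p (u - r) y" for y
  have jump: "\<exists>\<rho>>0. \<exists>w. (\<forall>y. c \<le> ereal y \<longrightarrow> v - \<rho> \<le> y \<longrightarrow> y \<le> v \<longrightarrow> W y = W v) \<and>
      (\<forall>y. v < y \<longrightarrow> y \<le> v + \<rho> \<longrightarrow> W y = w) \<and> int (multiplicity p u v) = W v - w"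
    if "c \<le> ereal v" for v
    unfolding W_def by (rule jump_at[OF uc that r strip])
  have inf: "int (multiplicity p u \<infinity>) = W \<infinity>"
  proof -
    obtain s C \<alpha> \<beta> where s: "s > 0" "u + s < C"
      "\<forall>a b. u \<le> a \<longrightarrow> a \<le> u + s \<longrightarrow> ereal C \<le> b \<longrightarrow> reg p a b = \<alpha>"
      "\<forall>a b. u - s \<le> a \<longrightarrow> a < u \<longrightarrow> ereal C \<le> b \<longrightarrow> reg p a b = \<beta>"
      "int (multiplicity p u \<infinity>) = \<alpha> - \<beta>"
      using corner_infinite[of u] by (elim exE conjE)
    have "reg p u \<infinity> = \<alpha>" using s(1) by (intro s(3)[rule_format]) auto
    moreover have "reg p (max (u - r) (u - s)) \<infinity> = \<beta>" using s(1) r by (intro s(4)[rule_format]) auto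
    moreover have "reg p (max (u - r) (u - s)) \<infinity> = reg p (u - r) \<infinity>"
      using s(1) r by (intro strip) auto
    ultimately show ?thesis using s(5) by (simp add: W_def)
  qed
  have fc: "finite ?K \<and> int (card ?K) = W c"
  proof (cases "c = \<infinity>")
    case True
    then have "?K = {\<infinity>} \<times> {..<multiplicity p u \<infinity>}" by auto
    then show ?thesis using inf True by (simp add: card_cartesian_product)
  next
    case False
    then obtain c' where c': "c = ereal c'" using uc by (cases c) auto
    obtain d0 where d0: "\<And>a b. a \<le> u \<Longrightarrow> ereal d0 \<le> b \<Longrightarrow> b \<le> \<infinity> \<Longrightarrow> reg p a b = reg p a \<infinity>"
      using strip_below[of u \<infinity>] by (metis ereal_less(4) ereal_infty_less(1) PInfty_neq_ereal(1))
    define d where "d = max d0 c'"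
    have d: "c' \<le> d" "\<And>b. ereal d \<le> b \<Longrightarrow> W b = W \<infinity>"
    proof -
      show "c' \<le> d" by (simp add: d_def)
      fix b assume "ereal d \<le> b"
      then have "ereal d0 \<le> b" by (metis d_def ereal_less_eq(3) max.cobounded1 order_trans)
      then show "W b = W \<infinity>" using d0[of u b] d0[of "u - r" b] r by (simp add: W_def)
    qed
    let ?S = "Sigma {c'..<d} (\<lambda>v. {..<multiplicity p u (ereal v)})"
    have S: "finite ?S \<and> int (card ?S) = W c' - W d"
    proof (rule jump_count[OF d(1), of "\<lambda>y. W (ereal y)"])
      fix x assume "c' \<le> x" "x \<le> d"
      then have "c \<le> ereal x" using c' by simp
      from jump[OF this]
      show "\<exists>\<rho>>0. \<exists>g'. (\<forall>y. c' \<le> y \<longrightarrow> x - \<rho> \<le> y \<longrightarrow> y \<le> x \<longrightarrow> W (ereal y) = W (ereal x)) \<and>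
        (\<forall>y. x < y \<longrightarrow> y \<le> x + \<rho> \<longrightarrow> W (ereal y) = g') \<and>
        finite {..<multiplicity p u (ereal x)} \<and> int (card {..<multiplicity p u (ereal x)}) = W (ereal x) - g'"
        by (simp add: c')
    qed
    have zero: "multiplicity p u (ereal v) = 0" if "d \<le> v" for v
    proof -
      have "c \<le> ereal v" using c' d(1) that by simp
      from jump[OF this] obtain \<rho> w where \<rho>: "\<rho> > 0" 
        "\<forall>y. v < y \<longrightarrow> y \<le> v + \<rho> \<longrightarrow> W y = w" "int (multiplicity p u v) = W v - w" by blast
      have "W (v + \<rho>) = w" using \<rho> by simp
      then show ?thesis using d(2)[of "ereal v"] d(2)[of "ereal (v + \<rho>)"] \<rho> that by simp
    qed
    have K: "?K = (\<lambda>(v, k). (ereal v, k)) ` ?S \<union> {\<infinity>} \<times> {..<multiplicity p u \<infinity>}"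
    proof (intro equalityI subsetI)
      fix z assume "z \<in> ?K"
      then obtain v k where z: "z = (v, k)" "c \<le> v" "k < multiplicity p u v" by auto
      show "z \<in> (\<lambda>(v, k). (ereal v, k)) ` ?S \<union> {\<infinity>} \<times> {..<multiplicity p u \<infinity>}"
      proof (cases v)
        case (real x)
        then have "x < d" using zero[of x] z by (cases "x < d") auto
        then show ?thesis using real z c' by auto
      next
        case PInf then show ?thesis using z by auto
      next
        case MInf then show ?thesis using z c' by auto
      qed
    qed (use c' in auto)
    have inj: "inj_on (\<lambda>(v, k). (ereal v, k)) ?S" by (auto simp: inj_on_def)
    have "card ?K = card ((\<lambda>(v, k). (ereal v, k)) ` ?S) + card ({\<infinity> :: ereal} \<times> {..<multiplicity p u \<infinity>})"
      unfolding K using S by (intro card_Un_disjoint) auto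
    then have "int (card ?K) = W c' - W d + W \<infinity>"
      using S inf by (simp add: card_image[OF inj] card_cartesian_product)
    moreover have "finite ?K" unfolding K using S by simp
    ultimately show ?thesis using d(2)[of "ereal d"] c' by simp
  qed
  show "finite ?K" using fc by blast
  show "int (card ?K) = reg p u c - reg p (u - r) c" using fc by (simp add: W_def)
qed

text \<open>A second application of \<open>jump_count\<close>, now across columns. The half-open
  sides match the one-sided continuity of \<open>reg p\<close>, which makes the count exact.\<close>

lemma quadrant_count:
  assumes "a \<le> a'" "ereal a' < c"
  shows "finite (corners p \<inter> ({a<..a'} \<times> {c..}) \<times> UNIV)" (is "finite ?Q")
    and "int (card (corners p \<inter> ({a<..a'} \<times> {c..}) \<times> UNIV)) = reg p a' c - reg p a c"
proof -
  let ?K = "\<lambda>u. {(v, k). c \<le> v \<and> k < multiplicity p u v}"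
  \<comment> \<open>The abscissa is negated because \<open>reg p\<close> is right-continuous in u,
    while \<open>jump_count\<close> expects left-continuity; {-a'..<-a} then corresponds to
    {a<..a'}.\<close>
  let ?S = "Sigma {-a'..<-a} (\<lambda>x. ?K (- x))"
  have S: "finite ?S \<and> int (card ?S) = reg p (- (- a')) c - reg p (- (- a)) c"
  proof (rule jump_count[of "- a'" "- a" "\<lambda>x. reg p (- x) c"])
    show "- a' \<le> - a" using assms by simp
    fix x assume x: "- a' \<le> x" "x \<le> - a"
    have uc: "ereal (- x) < c" using x assms
      by (metis ereal_less_eq(3) minus_le_iff order_le_less_trans)
    obtain r where r: "r > 0" "\<And>a b. - x \<le> a \<Longrightarrow> a \<le> - x + r \<Longrightarrow> c \<le> b \<Longrightarrow> reg p a b = reg p (- x) b"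
      using strip_right[OF uc] by metis
    obtain s where s: "s > 0"
      "\<And>a b. - x - s \<le> a \<Longrightarrow> a < - x \<Longrightarrow> c \<le> b \<Longrightarrow> reg p a b = reg p (- x - s) b"
      using strip_left[OF uc] by metis
    note K = column_count[OF uc s]
    show "\<exists>\<rho>>0. \<exists>g'. (\<forall>y. - a' \<le> y \<longrightarrow> x - \<rho> \<le> y \<longrightarrow> y \<le> x \<longrightarrow> reg p (- y) c = reg p (- x) c) \<and>
      (\<forall>y. x < y \<longrightarrow> y \<le> x + \<rho> \<longrightarrow> reg p (- y) c = g') \<and> finite (?K (- x)) \<and>
      int (card (?K (- x))) = reg p (- x) c - g'"
    proof (intro exI[of _ "min r s"] conjI exI[of _ "reg p (- x - s) c"] allI impI)
      show "finite (?K (- x))" "int (card (?K (- x))) = reg p (- x) c - reg p (- x - s) c"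
        using K by auto
      show "min r s > 0" using r(1) s(1) by simp
      show "reg p (- y) c = reg p (- x) c" if "x - min r s \<le> y" "y \<le> x" for y
        using that by (intro r(2)) auto
      show "reg p (- y) c = reg p (- x - s) c" if "x < y" "y \<le> x + min r s" for y
        using that by (intro s(2)) auto
    qed
  qed
  have Q: "?Q = (\<lambda>(x, (v, k)). ((- x, v), k)) ` ?S"
  proof (intro equalityI subsetI)
    fix z assume "z \<in> ?Q"
    then obtain u v k where z: "z = ((u, v), k)" "a < u" "u \<le> a'" "c \<le> v" "k < multiplicity p u v"
      by (auto simp: corners_def)
    then have "(- u, (v, k)) \<in> ?S" by auto
    then show "z \<in> (\<lambda>(x, (v, k)). ((- x, v), k)) ` ?S" unfolding z(1) by (rule rev_image_eqI) simp
  next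
    fix z assume "z \<in> (\<lambda>(x, (v, k)). ((- x, v), k)) ` ?S"
    then obtain x v k where z: "z = ((- x, v), k)" "- a' \<le> x" "x < - a" "c \<le> v" "k < multiplicity p (- x) v"
      by auto
    have "ereal (- x) \<le> ereal a'" using z by simp
    then have "ereal (- x) < v" using assms(2) z(4) by (meson order_le_less_trans order_less_le_trans)
    then show "z \<in> ?Q" using z by (auto simp: corners_def)
  qed
  have inj: "inj_on (\<lambda>(x, (v, k)). ((- x, v), k)) ?S" by (auto simp: inj_on_def)
  show "finite ?Q" unfolding Q using S by simp
  show "int (card ?Q) = reg p a' c - reg p a c"
    unfolding Q card_image[OF inj] using S by simp
qed

lemma box_count:
  assumes "a \<le> a'" "ereal a' < c" "c \<le> d"
  shows "finite (corners p \<inter> ({a<..a'} \<times> {c..<d}) \<times> UNIV)" (is "finite ?B")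
    and "int (card (corners p \<inter> ({a<..a'} \<times> {c..<d}) \<times> UNIV)) = reg p a' c - reg p a c - reg p a' d + reg p a d"
proof -
  let ?Q = "\<lambda>c. corners p \<inter> ({a<..a'} \<times> {c..}) \<times> UNIV"
  have "ereal a' < d" using assms by simp
  note 1 = quadrant_count[OF assms(1,2)] and 2 = quadrant_count[OF assms(1) this]
  have eq: "?Q c = ?B \<union> ?Q d" using assms by (auto intro: order_trans)
  have fin: "finite (?B \<union> ?Q d)" unfolding eq[symmetric] by (rule 1)
  then show fB: "finite ?B" by simp
  have "card (?Q c) = card ?B + card (?Q d)"
    unfolding eq using fin by (intro card_Un_disjoint) auto
  then show "int (card ?B) = reg p a' c - reg p a c - reg p a' d + reg p a d" using 1 2 by simp
qed

end

section \<open>Local stability\<close>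

definition interleaved :: "real \<Rightarrow> (real \<Rightarrow> ereal \<Rightarrow> int) \<Rightarrow> (real \<Rightarrow> ereal \<Rightarrow> int) \<Rightarrow> bool" where
  "interleaved \<eta> p q \<longleftrightarrow> (\<forall>u v. ereal u < v \<longrightarrow>
     q (u - \<eta>) (v + ereal \<eta>) \<le> p u v \<and> p (u - \<eta>) (v + ereal \<eta>) \<le> q u v)"

lemma interleaved_sym: "interleaved \<eta> p q \<Longrightarrow> interleaved \<eta> q p"
  by (auto simp: interleaved_def)

text \<open>A real bound separates finite from infinite heights, and since -\<infinity> -
  (-\<infinity>) is infinite in \<open>ereal\<close>, height -\<infinity> is excluded
  altogether.\<close>

lemma pdist_le_iff:
  "pdist (u, v) (u', v') \<le> ereal a \<longleftrightarrow> \<bar>u - u'\<bar> \<le> a \<and>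
     (v = \<infinity> \<and> v' = \<infinity> \<or> (\<exists>x y. v = ereal x \<and> v' = ereal y \<and> \<bar>x - y\<bar> \<le> a))"
  by (cases v; cases v') (auto simp: pdist_def vdist_def)

lemma pdist_triangle_le:
  assumes "pdist x y \<le> ereal a" "pdist y z \<le> ereal b"
  shows "pdist x z \<le> ereal (a + b)"
proof -
  have "pdist (fst x, snd x) (fst y, snd y) \<le> ereal a" "pdist (fst y, snd y) (fst z, snd z) \<le> ereal b"
    using assms by auto
  then have "pdist (fst x, snd x) (fst z, snd z) \<le> ereal (a + b)"
    unfolding pdist_le_iff by fastforce
  then show ?thesis by simp
qed

lemma pdist_commute: "pdist x y = pdist y x"
proof -
  have "vdist v v' = vdist v' v" for v v'
    by (cases v; cases v') (auto simp: vdist_def abs_minus_commute)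
  then show ?thesis by (simp add: pdist_def abs_minus_commute)
qed

lemma reg_interleaved:
  assumes "categorical_pf p" "categorical_pf q" "interleaved \<eta> p q" "ereal u < v"
    and "0 \<le> \<eta>"
  shows "reg q (u - \<eta>) (v + ereal \<eta>) \<le> reg p u v"
proof -
  interpret p: cpf p by unfold_locales fact
  interpret q: cpf q by unfold_locales fact
  obtain a b where ab: "u < a" "a < b" "ereal b < v" "p a (ereal b) = reg p u v"
    by (rule p.reg_attained[OF assms(4)]) blast
  have "ereal (b + \<eta>) < v + ereal \<eta>" using ab(3) by (cases v) auto
  then have "reg q (u - \<eta>) (v + ereal \<eta>) \<le> q (a - \<eta>) (ereal (b + \<eta>))"
    using ab assms(5) by (intro q.reg_le) auto
  also have "\<dots> = q (a - \<eta>) (ereal b + ereal \<eta>)" by simp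
  also have "\<dots> \<le> p a (ereal b)"
    using assms(3) ab(2) unfolding interleaved_def by (meson less_ereal.simps(1))
  finally show ?thesis using ab by simp
qed

context cpf
begin

lemma reg_sandwich:
  assumes "categorical_pf q" "interleaved \<eta> p q" "0 \<le> \<eta>" "ereal (a + \<eta>) < c - ereal \<eta>"
  shows "reg p (a - \<eta>) (c + ereal \<eta>) \<le> reg q a c" "reg q a c \<le> reg p (a + \<eta>) (c - ereal \<eta>)"
proof -
  have "ereal a < c" using assms(3,4) by (cases c) auto
  then show "reg p (a - \<eta>) (c + ereal \<eta>) \<le> reg q a c"
    by (rule reg_interleaved[OF assms(1) cat interleaved_sym[OF assms(2)] _ assms(3)])
  have "c - ereal \<eta> + ereal \<eta> = c" using assms(4) by (cases c) auto
  then show "reg q a c \<le> reg p (a + \<eta>) (c - ereal \<eta>)"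
    using reg_interleaved[OF cat assms(1,2,4,3)] by simp
qed

text \<open>In the four open quadrants at (u, v) the function is locally constant, so the
interleaving inequalities pin down q there exactly.\<close>

lemma local_stability:
  assumes "ereal u < v"
  shows "\<exists>U r. open U \<and> (u, v) \<in> U \<and> r > 0 \<and> (\<forall>q \<eta>. categorical_pf q \<longrightarrow> 0 < \<eta> \<longrightarrow> \<eta> < r \<longrightarrow>
    interleaved \<eta> p q \<longrightarrow> (\<exists>F. finite F \<and> card F = multiplicity p u v \<and> F \<subseteq> corners q \<and>
      (\<forall>y\<in>F. pdist (u, v) (fst y) \<le> ereal \<eta>) \<and> (\<forall>y\<in>corners q. fst y \<in> U \<longrightarrow> y \<in> F)))"
proof (cases v)
  case (real v')
  then have uv: "u < v'" using assms by simp
  obtain s \<alpha> \<beta> \<gamma> \<delta> where s: "s > 0" "u + s < v' - s"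
    "\<forall>a b. u \<le> a \<longrightarrow> a \<le> u + s \<longrightarrow> v' - s \<le> b \<longrightarrow> b \<le> v' \<longrightarrow> reg p a (ereal b) = \<alpha>"
    "\<forall>a b. u - s \<le> a \<longrightarrow> a < u \<longrightarrow> v' - s \<le> b \<longrightarrow> b \<le> v' \<longrightarrow> reg p a (ereal b) = \<beta>"
    "\<forall>a b. u \<le> a \<longrightarrow> a \<le> u + s \<longrightarrow> v' < b \<longrightarrow> b \<le> v' + s \<longrightarrow> reg p a (ereal b) = \<gamma>"
    "\<forall>a b. u - s \<le> a \<longrightarrow> a < u \<longrightarrow> v' < b \<longrightarrow> b \<le> v' + s \<longrightarrow> reg p a (ereal b) = \<delta>"
    "int (multiplicity p u (ereal v')) = \<alpha> - \<beta> - \<gamma> + \<delta>"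
    using corner_finite[OF uv] by (elim exE conjE)
  \<comment> \<open>The values of q are determined at offsets between \<eta> and 3 r: a shift by
    \<eta> < r stays in the same quadrant and within s = 4 r.\<close>
  define r where "r = s / 4"
  have r: "r > 0" "s = 4 * r" using s(1) by (auto simp: r_def)
  define U where "U = {u - 2 * r<..<u + 2 * r} \<times> {ereal (v' - 2 * r)<..<ereal (v' + 2 * r)}"
  have "\<exists>F. finite F \<and> card F = multiplicity p u v \<and> F \<subseteq> corners q \<and>
      (\<forall>y\<in>F. pdist (u, v) (fst y) \<le> ereal \<eta>) \<and> (\<forall>y\<in>corners q. fst y \<in> U \<longrightarrow> y \<in> F)"
    if q: "categorical_pf q" and \<eta>: "0 < \<eta>" "\<eta> < r" and pq: "interleaved \<eta> p q" for q \<eta>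
  proof -
    interpret q: cpf q by unfold_locales fact
    have sw: "reg p (a - \<eta>) (ereal (b + \<eta>)) \<le> reg q a (ereal b)"
      "reg q a (ereal b) \<le> reg p (a + \<eta>) (ereal (b - \<eta>))" if "a + \<eta> < b - \<eta>" for a b
      using reg_sandwich[OF q pq, of a "ereal b"] that \<eta> by auto
    have \<alpha>: "reg q a (ereal b) = \<alpha>"
      if "u + \<eta> \<le> a" "a \<le> u + 3 * r" "v' - 3 * r \<le> b" "b \<le> v' - \<eta>" for a b
    proof -
      have "reg p (a - \<eta>) (ereal (b + \<eta>)) = \<alpha>" "reg p (a + \<eta>) (ereal (b - \<eta>)) = \<alpha>"
        using that \<eta> r by (auto intro!: s(3)[rule_format])
      moreover have "a + \<eta> < b - \<eta>" using that \<eta> r s(2) by linarith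
      ultimately show ?thesis using sw[of a b] by linarith
    qed
    have \<beta>: "reg q a (ereal b) = \<beta>"
      if "u - 3 * r \<le> a" "a < u - \<eta>" "v' - 3 * r \<le> b" "b \<le> v' - \<eta>" for a b
    proof -
      have "reg p (a - \<eta>) (ereal (b + \<eta>)) = \<beta>" "reg p (a + \<eta>) (ereal (b - \<eta>)) = \<beta>"
        using that \<eta> r by (auto intro!: s(4)[rule_format])
      moreover have "a + \<eta> < b - \<eta>" using that \<eta> r s(2) by linarith
      ultimately show ?thesis using sw[of a b] by linarith
    qed
    have \<gamma>: "reg q a (ereal b) = \<gamma>"
      if "u + \<eta> \<le> a" "a \<le> u + 3 * r" "v' + \<eta> < b" "b \<le> v' + 3 * r" for a b
    proof -
      have "reg p (a - \<eta>) (ereal (b + \<eta>)) = \<gamma>" "reg p (a + \<eta>) (ereal (b - \<eta>)) = \<gamma>"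
        using that \<eta> r by (auto intro!: s(5)[rule_format])
      moreover have "a + \<eta> < b - \<eta>" using that \<eta> r s(2) by linarith
      ultimately show ?thesis using sw[of a b] by linarith
    qed
    have \<delta>: "reg q a (ereal b) = \<delta>"
      if "u - 3 * r \<le> a" "a < u - \<eta>" "v' + \<eta> < b" "b \<le> v' + 3 * r" for a b
    proof -
      have "reg p (a - \<eta>) (ereal (b + \<eta>)) = \<delta>" "reg p (a + \<eta>) (ereal (b - \<eta>)) = \<delta>"
        using that \<eta> r by (auto intro!: s(6)[rule_format])
      moreover have "a + \<eta> < b - \<eta>" using that \<eta> r s(2) by linarith
      ultimately show ?thesis using sw[of a b] by linarith
    qed
    define B where "B a a' c d = corners q \<inter> ({a<..a'} \<times> {ereal c..<ereal d}) \<times> UNIV" for a a' c d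
    have B: "finite (B a a' c d) \<and> card (B a a' c d) = multiplicity p u v"
      if "u - 3 * r \<le> a" "a < u - \<eta>" "u + \<eta> \<le> a'" "a' \<le> u + 3 * r"
        "v' - 3 * r \<le> c" "c \<le> v' - \<eta>" "v' + \<eta> < d" "d \<le> v' + 3 * r" for a a' c d
    proof -
      have "a \<le> a'" "ereal a' < ereal c" "ereal c \<le> ereal d" using that \<eta> r s(2) by auto
      note q.box_count[OF this]
      then show ?thesis using s(7) that \<alpha>[of a' c] \<beta>[of a c] \<gamma>[of a' d] \<delta>[of a d] real
        by (simp add: B_def)
    qed
    let ?F = "B (u - 2 * r) (u + 2 * r) (v' - 2 * r) (v' + 2 * r)"
    have F: "finite ?F" "card ?F = multiplicity p u v" using B \<eta> r by auto
    have "pdist (u, v) (fst y) \<le> ereal \<eta>" if y: "y \<in> ?F" for y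
    proof -
      \<comment> \<open>The small box lies in the large one and has the same number of cornerpoints,
        so they coincide. The extra \<epsilon> is needed on the left and upper sides, where the
        quadrant values hold only strictly beyond \<eta>; it tends to 0 afterwards.\<close>
      have sub: "y \<in> B (u - \<eta> - \<epsilon>) (u + \<eta>) (v' - \<eta>) (v' + \<eta> + \<epsilon>)" if e: "0 < \<epsilon>" "\<epsilon> \<le> r / 2" for \<epsilon>
      proof -
        let ?B = "B (u - \<eta> - \<epsilon>) (u + \<eta>) (v' - \<eta>) (v' + \<eta> + \<epsilon>)"
        have "?B \<subseteq> ?F" unfolding B_def using e \<eta> by (intro Int_mono Sigma_mono) auto
        moreover have "card ?B = multiplicity p u v" using B[of "u - \<eta> - \<epsilon>"] e \<eta> r by simp
        ultimately have "?B = ?F" using F by (intro card_subset_eq) auto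
        then show ?thesis using y by simp
      qed
      obtain a b k where yk: "y = ((a, b), k)" by (metis surj_pair)
      have "y \<in> B (u - \<eta> - r / 2) (u + \<eta>) (v' - \<eta>) (v' + \<eta> + r / 2)" using sub r by simp
      then obtain b' where b': "b = ereal b'" "a \<le> u + \<eta>" "v' - \<eta> \<le> b'"
        using yk by (cases b) (auto simp: B_def)
      have lt: "u - \<eta> < a + \<epsilon> \<and> b' < v' + \<eta> + \<epsilon>" if "0 < \<epsilon>" for \<epsilon>
      proof -
        have "0 < min \<epsilon> (r / 2)" "min \<epsilon> (r / 2) \<le> r / 2" using that r(1) by auto
        from sub[OF this] have "u - \<eta> - min \<epsilon> (r / 2) < a \<and> b' < v' + \<eta> + min \<epsilon> (r / 2)"
          using yk b' by (simp add: B_def)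
        then show ?thesis by linarith
      qed
      have "u - \<eta> \<le> a" "b' \<le> v' + \<eta>" by (rule field_le_epsilon, use lt in force)+
      then show ?thesis using b' yk real by (auto simp: pdist_le_iff)
    qed
    moreover have "\<forall>y\<in>corners q. fst y \<in> U \<longrightarrow> y \<in> ?F" by (auto simp: U_def B_def)
    moreover have "?F \<subseteq> corners q" by (auto simp: B_def)
    ultimately show ?thesis using F by (intro exI[of _ ?F]) blast
  qed
  moreover have "open U" unfolding U_def by (intro open_Times open_greaterThanLessThan)
  moreover have "(u, v) \<in> U" using r real by (simp add: U_def)
  ultimately show ?thesis using r(1) by (intro exI[of _ U] exI[of _ r]) blast
next
  case PInf
  obtain s C \<alpha> \<beta> where s: "s > 0" "u + s < C"
    "\<forall>a b. u \<le> a \<longrightarrow> a \<le> u + s \<longrightarrow> ereal C \<le> b \<longrightarrow> reg p a b = \<alpha>"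
    "\<forall>a b. u - s \<le> a \<longrightarrow> a < u \<longrightarrow> ereal C \<le> b \<longrightarrow> reg p a b = \<beta>"
    "int (multiplicity p u \<infinity>) = \<alpha> - \<beta>"
    using corner_infinite[of u] by (elim exE conjE)
  define r where "r = s / 4"
  have r: "r > 0" "s = 4 * r" using s(1) by (auto simp: r_def)
  define U where "U = {u - 2 * r<..<u + 2 * r} \<times> {ereal (C + r)<..}"
  have "\<exists>F. finite F \<and> card F = multiplicity p u v \<and> F \<subseteq> corners q \<and>
      (\<forall>y\<in>F. pdist (u, v) (fst y) \<le> ereal \<eta>) \<and> (\<forall>y\<in>corners q. fst y \<in> U \<longrightarrow> y \<in> F)"
    if q: "categorical_pf q" and \<eta>: "0 < \<eta>" "\<eta> < r" and pq: "interleaved \<eta> p q" for q \<eta>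
  proof -
    interpret q: cpf q by unfold_locales fact
    have lt: "ereal (a + \<eta>) < c - ereal \<eta>" "ereal C \<le> c - ereal \<eta>" "ereal C \<le> c + ereal \<eta>"
      if "a \<le> u + 3 * r" "ereal (C + r) \<le> c" for a c
      using that \<eta> r s(2) by (cases c; auto)+
    have \<alpha>: "reg q a c = \<alpha>" if "u + \<eta> \<le> a" "a \<le> u + 3 * r" "ereal (C + r) \<le> c" for a c
    proof -
      have "reg p (a - \<eta>) (c + ereal \<eta>) = \<alpha>" "reg p (a + \<eta>) (c - ereal \<eta>) = \<alpha>"
        using that \<eta> r lt[of a c] by (auto intro!: s(3)[rule_format])
      then show ?thesis using reg_sandwich[OF q pq _ lt(1)[of a c]] that \<eta> by simp
    qed
    have \<beta>: "reg q a c = \<beta>" if "u - 3 * r \<le> a" "a < u - \<eta>" "ereal (C + r) \<le> c" for a c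
    proof -
      have a: "a \<le> u + 3 * r" using that \<eta> r by linarith
      have "reg p (a - \<eta>) (c + ereal \<eta>) = \<beta>" "reg p (a + \<eta>) (c - ereal \<eta>) = \<beta>"
        using that \<eta> r lt[OF a that(3)] by (auto intro!: s(4)[rule_format])
      then show ?thesis using reg_sandwich[OF q pq _ lt(1)[OF a that(3)]] that \<eta> by simp
    qed
    define B where "B a a' c = corners q \<inter> ({a<..a'} \<times> {c..}) \<times> UNIV" for a a' c
    have B: "finite (B a a' c) \<and> card (B a a' c) = multiplicity p u v"
      if "u - 3 * r \<le> a" "a < u - \<eta>" "u + \<eta> \<le> a'" "a' \<le> u + 3 * r" "ereal (C + r) \<le> c" for a a' c
    proof -
      have "a \<le> a'" "ereal a' < c" using that \<eta> r s(2) by (cases c; auto)+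
      note q.quadrant_count[OF this]
      then show ?thesis using s(5) that \<alpha>[of a' c] \<beta>[of a c] PInf by (simp add: B_def)
    qed
    let ?F = "B (u - 2 * r) (u + 2 * r) (ereal (C + r))"
    have F: "finite ?F" "card ?F = multiplicity p u v" using B \<eta> r by auto
    have "pdist (u, v) (fst y) \<le> ereal \<eta>" if y: "y \<in> ?F" for y
    proof -
      \<comment> \<open>The quadrant based at height \<infinity> already has the full count, so
        every cornerpoint of q found here has infinite height.\<close>
      have sub: "y \<in> B (u - \<eta> - \<epsilon>) (u + \<eta>) \<infinity>" if e: "0 < \<epsilon>" "\<epsilon> \<le> r / 2" for \<epsilon>
      proof -
        let ?B = "B (u - \<eta> - \<epsilon>) (u + \<eta>) \<infinity>"
        have "?B \<subseteq> ?F" unfolding B_def using e \<eta> by (intro Int_mono Sigma_mono) auto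
        moreover have "card ?B = multiplicity p u v" using B[of "u - \<eta> - \<epsilon>"] e \<eta> r by simp
        ultimately have "?B = ?F" using F by (intro card_subset_eq) auto
        then show ?thesis using y by simp
      qed
      obtain a b k where yk: "y = ((a, b), k)" by (metis surj_pair)
      have "y \<in> B (u - \<eta> - r / 2) (u + \<eta>) \<infinity>" using sub r by simp
      then have b: "b = \<infinity>" "a \<le> u + \<eta>" using yk by (auto simp: B_def)
      have lt: "u - \<eta> < a + \<epsilon>" if "0 < \<epsilon>" for \<epsilon>
      proof -
        have "0 < min \<epsilon> (r / 2)" "min \<epsilon> (r / 2) \<le> r / 2" using that r(1) by auto
        from sub[OF this] have "u - \<eta> - min \<epsilon> (r / 2) < a" using yk by (simp add: B_def)
        then show ?thesis by linarith
      qed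
      have "u - \<eta> \<le> a" by (rule field_le_epsilon, use lt in force)+
      then show ?thesis using b yk PInf by (auto simp: pdist_le_iff)
    qed
    moreover have "\<forall>y\<in>corners q. fst y \<in> U \<longrightarrow> y \<in> ?F" by (auto simp: U_def B_def)
    moreover have "?F \<subseteq> corners q" by (auto simp: B_def)
    ultimately show ?thesis using F by (intro exI[of _ ?F]) blast
  qed
  moreover have "open U" unfolding U_def by (intro open_Times open_greaterThanLessThan open_greaterThan)
  moreover have "(u, v) \<in> U" using r PInf by (simp add: U_def)
  ultimately show ?thesis using r(1) by (intro exI[of _ U] exI[of _ r]) blast
qed (use assms in auto)

text \<open>Finite quadrants with rational vertices cover the region above the diagonal.
  Countability later allows distinct labels for cornerpoints sent to the same diagonal
  point.\<close>

lemma countable_corners: "countable (corners p)"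
proof -
  let ?B = "\<lambda>(n::nat, a'::rat, c::rat). corners p \<inter> ({- real n<..of_rat a'} \<times> {ereal (of_rat c)..}) \<times> UNIV"
  let ?I = "{(n::nat, a'::rat, c::rat). - real n \<le> of_rat a' \<and> (of_rat a' :: real) < of_rat c}"
  have "countable (\<Union>i\<in>?I. ?B i)"
  proof (intro countable_UN countableI_type)
    fix i assume "i \<in> ?I"
    then have "finite (?B i)" by (auto intro!: quadrant_count(1))
    then show "countable (?B i)" by (rule countable_finite)
  qed
  moreover have "corners p \<subseteq> (\<Union>i\<in>?I. ?B i)"
  proof
    fix y assume y: "y \<in> corners p"
    then obtain u v k where yk: "y = ((u, v), k)" "ereal u < v" by (auto simp: corners_def)
    obtain w where w: "u < w" "ereal w < v" using ereal_dense2[OF yk(2)] by auto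
    obtain a' where a': "u < of_rat a'" "of_rat a' < w" using of_rat_dense[OF w(1)] by blast
    obtain c where c: "real_of_rat a' < of_rat c" "of_rat c < w" using of_rat_dense[OF a'(2)] by blast
    obtain n where n: "- u < real n" using reals_Archimedean2 by blast
    have "ereal (of_rat c) \<le> v" using c w by (meson ereal_less_eq(3) less_imp_le order_trans)
    then have "(n, a', c) \<in> ?I" "y \<in> ?B (n, a', c)" using y yk a' c n by auto
    then show "y \<in> (\<Union>i\<in>?I. ?B i)" by blast
  qed
  ultimately show ?thesis by (rule countable_subset[rotated])
qed

end

section \<open>Matching along a path of persistence functions\<close>

lemma uniform_positive:
  fixes Q :: "'a \<Rightarrow> real \<Rightarrow> bool"
  assumes "finite S" "\<And>x. x \<in> S \<Longrightarrow> \<exists>r>0. Q x r"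
    and anti: "\<And>x r r'. Q x r \<Longrightarrow> 0 < r' \<Longrightarrow> r' \<le> r \<Longrightarrow> Q x r'"
  shows "\<exists>r>0. \<forall>x\<in>S. Q x r"
  using assms(1,2)
proof (induction S rule: finite_induct)
  case empty
  then show ?case by (auto intro: exI[of _ 1])
next
  case (insert x S)
  then obtain r where r: "r > 0" "\<forall>x\<in>S. Q x r" by blast
  obtain s where s: "s > 0" "Q x s" using insert by blast
  show ?case using r s anti by (intro exI[of _ "min r s"]) (auto intro: anti)
qed

definition nbh :: "(real \<times> ereal) set \<Rightarrow> real \<Rightarrow> (real \<times> ereal) set" where
  "nbh A \<rho> = {y. \<exists>x\<in>A. pdist x y \<le> ereal \<rho>}"

text \<open>Compactness refers to the topology of \<open>ereal\<close>, in which the open sets of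
  \<open>local_stability\<close> are given; a ball of \<open>pdist\<close> around a point at
  infinity is a segment at height \<infinity>.\<close>

lemma compact_nbh:
  assumes "finite A" "\<And>x. x \<in> A \<Longrightarrow> snd x \<noteq> -\<infinity>"
  shows "compact (nbh A \<rho>)"
proof -
  have "compact {y. pdist x y \<le> ereal \<rho>}" if x: "x \<in> A" for x
  proof (cases "0 \<le> \<rho>")
    case False
    have "\<not> pdist x y \<le> ereal \<rho>" for y
      using False pdist_le_iff[of "fst x" "snd x" "fst y" "snd y" \<rho>] by auto
    then show ?thesis by simp
  next
    case True
    obtain u v where uv: "x = (u, v)" by (metis surj_pair)
    show ?thesis
    proof (cases v)
      case (real v')
      have "{y. pdist x y \<le> ereal \<rho>} = {u - \<rho>..u + \<rho>} \<times> ereal ` {v' - \<rho>..v' + \<rho>}"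
        using uv real by (auto simp: pdist_le_iff abs_le_iff)
      moreover have "continuous_on {v' - \<rho>..v' + \<rho>} ereal"
        by (auto simp: continuous_on_def intro!: tendsto_intros)
      ultimately show ?thesis by (simp add: compact_Times compact_continuous_image)
    next
      case PInf
      have "{y. pdist x y \<le> ereal \<rho>} = {u - \<rho>..u + \<rho>} \<times> {\<infinity>}"
        using uv PInf by (auto simp: pdist_le_iff abs_le_iff)
      then show ?thesis by (simp add: compact_Times)
    qed (use assms(2)[OF x] uv in auto)
  qed
  moreover have "nbh A \<rho> = (\<Union>x\<in>A. {y. pdist x y \<le> ereal \<rho>})" by (auto simp: nbh_def)
  ultimately show ?thesis using assms(1) by (simp add: compact_UN)
qed

lemma pdist_separated:
  assumes "x \<noteq> y" "snd x \<noteq> -\<infinity>"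
  shows "\<exists>\<sigma>>0. \<not> pdist x y \<le> ereal \<sigma>"
proof (rule ccontr)
  assume "\<not> ?thesis"
  then have *: "pdist (fst x, snd x) (fst y, snd y) \<le> ereal \<sigma>" if "\<sigma> > 0" for \<sigma> using that by auto
  have "\<bar>fst x - fst y\<bar> \<le> 0 + \<sigma>" if "\<sigma> > 0" for \<sigma>
    using *[OF that] unfolding pdist_le_iff by simp
  then have "\<bar>fst x - fst y\<bar> \<le> 0" by (rule field_le_epsilon)
  moreover have "snd x = snd y"
  proof (cases "snd x")
    case (real v)
    then obtain v' where v': "snd y = ereal v'" using *[of 1] unfolding pdist_le_iff by auto
    have "\<bar>v - v'\<bar> \<le> 0 + \<sigma>" if "\<sigma> > 0" for \<sigma>
      using *[OF that] real v' unfolding pdist_le_iff by simp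
    then have "\<bar>v - v'\<bar> \<le> 0" by (rule field_le_epsilon)
    then show ?thesis using real v' by simp
  next
    case PInf
    then show ?thesis using *[of 1] unfolding pdist_le_iff by simp
  qed (use assms(2) in simp)
  ultimately show False using assms(1) by (simp add: prod_eq_iff)
qed

section \<open>Monotone counts along the path\<close>

locale pf_family =
  fixes p :: "real \<Rightarrow> real \<Rightarrow> ereal \<Rightarrow> int" and h :: real
  assumes h: "0 < h"
    and cat_family: "\<And>t. 0 \<le> t \<Longrightarrow> t \<le> 1 \<Longrightarrow> categorical_pf (p t)"
    and inter: "\<And>s t \<eta>. 0 \<le> s \<Longrightarrow> s \<le> 1 \<Longrightarrow> 0 \<le> t \<Longrightarrow> t \<le> 1 \<Longrightarrow> 0 < \<eta> \<Longrightarrow>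
      h * \<bar>s - t\<bar> \<le> \<eta> \<Longrightarrow> interleaved \<eta> (p s) (p t)"
begin

definition near :: "(real \<times> ereal) set \<Rightarrow> real \<Rightarrow> ((real \<times> ereal) \<times> nat) set" where
  "near A t = corners (p t) \<inter> nbh A (t * h) \<times> UNIV"

text \<open>The conclusion of \<open>local_stability\<close> for \<open>p T\<close> at x, named so
  that \<open>U\<close> and \<open>r\<close> can be chosen for each x and r then shrunk
  uniformly.\<close>

definition stable :: "real \<Rightarrow> (real \<times> ereal) \<Rightarrow> (real \<times> ereal) set \<Rightarrow> real \<Rightarrow> bool" where
  "stable T x U r \<longleftrightarrow> (\<forall>q \<eta>. categorical_pf q \<longrightarrow> 0 < \<eta> \<longrightarrow> \<eta> < r \<longrightarrow>
    interleaved \<eta> (p T) q \<longrightarrow> (\<exists>F. finite F \<and> card F = multiplicity (p T) (fst x) (snd x) \<and> F \<subseteq> corners q \<and>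
      (\<forall>y\<in>F. pdist x (fst y) \<le> ereal \<eta>) \<and> (\<forall>y\<in>corners q. fst y \<in> U \<longrightarrow> y \<in> F)))"

lemma stable_exists:
  assumes "0 \<le> T" "T \<le> 1" "ereal (fst x) < snd x"
  shows "\<exists>U r. open U \<and> x \<in> U \<and> r > 0 \<and> stable T x U r"
proof -
  interpret cpf "p T" using cat_family[OF assms(1,2)] by unfold_locales
  show ?thesis using local_stability[OF assms(3)] by (simp add: stable_def)
qed

lemma stableD:
  assumes "stable T x U r" "categorical_pf q" "0 < \<eta>" "\<eta> < r" "interleaved \<eta> (p T) q"
  shows "\<exists>F. finite F \<and> card F = multiplicity (p T) (fst x) (snd x) \<and> F \<subseteq> corners q \<and>
    (\<forall>y\<in>F. pdist x (fst y) \<le> ereal \<eta>) \<and> (\<forall>y\<in>corners q. fst y \<in> U \<longrightarrow> y \<in> F)"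
  using assms unfolding stable_def by simp

lemma stable_anti: "stable T x U r \<Longrightarrow> r' \<le> r \<Longrightarrow> stable T x U r'"
  unfolding stable_def by simp

context
  fixes A :: "(real \<times> ereal) set"
  assumes finA: "finite A" and far: "\<And>x. x \<in> A \<Longrightarrow> ereal (fst x + 2 * h) < snd x"
begin

text \<open>Moving both coordinates by at most t h <= h shrinks v - u by at most 2 h.\<close>

lemma nbh_above_diagonal:
  assumes "y \<in> nbh A (t * h)" "0 \<le> t" "t \<le> 1"
  shows "ereal (fst y) < snd y"
proof -
  obtain x where x: "x \<in> A" "pdist (fst x, snd x) (fst y, snd y) \<le> ereal (t * h)"
    using assms by (auto simp: nbh_def)
  have "t * h \<le> h" using assms h by (simp add: mult_left_le_one_le)
  then show ?thesis using x(2) far[OF x(1)] unfolding pdist_le_iff by auto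
qed

text \<open>For s <= T the set \<open>near A s\<close> lies over the compact neighbourhood of radius
  T h. Finitely many stable sets \<open>U x\<close> cover it, and each captures at most the
  multiplicity of x at time T. The sum of these multiplicities counts labels in
  \<open>near A T\<close>.\<close>

lemma near_upper:
  assumes T: "0 \<le> T" "T \<le> 1"
  shows "finite (near A T)"
    and "\<exists>d>0. \<forall>s. 0 \<le> s \<longrightarrow> s \<le> T \<longrightarrow> T - s < d \<longrightarrow> card (near A s) \<le> card (near A T)"
proof -
  let ?K = "nbh A (T * h)"
  let ?m = "\<lambda>x. multiplicity (p T) (fst x) (snd x)"
  have "snd x \<noteq> -\<infinity>" if "x \<in> A" for x using far[OF that] by auto
  then have K: "compact ?K" by (intro compact_nbh finA)
  have "\<exists>U r. open U \<and> x \<in> U \<and> r > 0 \<and> stable T x U r" if "x \<in> ?K" for x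
    using stable_exists[OF T nbh_above_diagonal[OF that T]] .
  then obtain U r where U: "\<And>x. x \<in> ?K \<Longrightarrow> open (U x) \<and> x \<in> U x \<and> r x > 0 \<and> stable T x (U x) (r x)"
    by metis
  obtain X where X: "X \<subseteq> ?K" "finite X" "?K \<subseteq> (\<Union>x\<in>X. U x)"
    by (rule compactE_image[OF K, of ?K U]) (use U in auto)
  have "\<exists>R>0. \<forall>x\<in>X. stable T x (U x) R"
    using X(2) by (rule uniform_positive) (use U X(1) stable_anti in blast)+
  then obtain R where R: "R > 0" "\<And>x. x \<in> X \<Longrightarrow> stable T x (U x) R" by blast
  define N where "N = Sigma X (\<lambda>x. {..<?m x})"
  have fN: "finite N" using X(2) by (simp add: N_def)
  have sub: "finite (near A s) \<and> card (near A s) \<le> card N"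
    if s: "0 \<le> s" "s \<le> T" "h * (T - s) < R" for s
  proof -
    have s1: "s \<le> 1" using s T by simp
    \<comment> \<open>The term \<open>R / 2\<close> keeps \<eta> positive when s = T; that case
      yields finiteness at time T.\<close>
    define \<eta> where "\<eta> = max (h * (T - s)) (R / 2)"
    have \<eta>: "0 < \<eta>" "\<eta> < R" "h * \<bar>T - s\<bar> \<le> \<eta>" using s R by (auto simp: \<eta>_def)
    note stableD[OF R(2) cat_family[OF s(1) s1] \<eta>(1,2) inter[OF T s(1) s1 \<eta>(1,3)]]
    then have "\<forall>x\<in>X. \<exists>F. finite F \<and> card F = ?m x \<and> (\<forall>y\<in>corners (p s). fst y \<in> U x \<longrightarrow> y \<in> F)"
      by meson
    then obtain F where F: "\<And>x. x \<in> X \<Longrightarrow> finite (F x) \<and> card (F x) = ?m x \<and>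
      (\<forall>y\<in>corners (p s). fst y \<in> U x \<longrightarrow> y \<in> F x)" by metis
    have "near A s \<subseteq> (\<Union>x\<in>X. F x)"
    proof
      fix y assume y: "y \<in> near A s"
      then have "fst y \<in> nbh A (s * h)" by (auto simp: near_def)
      then obtain x where x: "x \<in> A" "pdist x (fst y) \<le> ereal (s * h)" by (auto simp: nbh_def)
      note x(2)
      also have "ereal (s * h) \<le> ereal (T * h)" using s h by (simp add: mult_right_mono)
      finally have "fst y \<in> ?K" using x(1) by (auto simp: nbh_def)
      then obtain x where "x \<in> X" "fst y \<in> U x" using X(3) by blast
      then show "y \<in> (\<Union>x\<in>X. F x)" using F[of x] y by (auto simp: near_def)
    qed
    moreover have fin: "finite (\<Union>x\<in>X. F x)" using F X(2) by blast
    moreover have "card (\<Union>x\<in>X. F x) \<le> (\<Sum>x\<in>X. card (F x))" by (rule card_UN_le[OF X(2)])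
    moreover have "(\<Sum>x\<in>X. card (F x)) = card N" unfolding N_def using F X(2) by (subst card_SigmaI) auto
    ultimately show ?thesis using card_mono[OF fin] by (metis finite_subset order_trans)
  qed
  show fT: "finite (near A T)" using sub[of T] T R by simp
  have "N \<subseteq> near A T"
  proof
    fix y assume "y \<in> N"
    then obtain x k where y: "y = (x, k)" "x \<in> X" "k < ?m x" by (auto simp: N_def)
    then have "x \<in> ?K" using X(1) by blast
    then show "y \<in> near A T" using nbh_above_diagonal[OF _ T, of x] y
      by (cases x) (auto simp: near_def corners_def)
  qed
  then have "card N \<le> card (near A T)" using fT by (intro card_mono)
  moreover have "h * (T - s) < R" if "T - s < R / h" for s using that h by (simp add: field_simps)
  moreover have "R / h > 0" using R h by simp
  ultimately show "\<exists>d>0. \<forall>s. 0 \<le> s \<longrightarrow> s \<le> T \<longrightarrow> T - s < d \<longrightarrow> card (near A s) \<le> card (near A T)"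
    using sub by (meson order_trans)
qed

text \<open>Each point of multiplicity m at time T yields m cornerpoints at time s within h (s - T),
  and T h + h (s - T) = s h keeps them near \<open>A\<close>. For short times the groups of
  different points are disjoint.\<close>

lemma near_lower:
  assumes T: "0 \<le> T" "T \<le> 1"
  shows "\<exists>d>0. \<forall>s. T \<le> s \<longrightarrow> s \<le> 1 \<longrightarrow> s - T < d \<longrightarrow> card (near A T) \<le> card (near A s)"
proof -
  let ?m = "\<lambda>x. multiplicity (p T) (fst x) (snd x)"
  define B where "B = fst ` near A T"
  have fB: "finite B" unfolding B_def using near_upper(1)[OF T] by (rule finite_imageI)
  have BK: "x \<in> nbh A (T * h)" if "x \<in> B" for x using that by (auto simp: B_def near_def)
  have Bd: "ereal (fst x) < snd x" if "x \<in> B" for x using nbh_above_diagonal[OF BK[OF that] T] .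
  have nT: "near A T = Sigma B (\<lambda>x. {..<?m x})"
  proof (intro equalityI subsetI)
    fix y assume "y \<in> Sigma B (\<lambda>x. {..<?m x})"
    then obtain x k where y: "y = (x, k)" "x \<in> B" "k < ?m x" by auto
    then show "y \<in> near A T" using Bd[of x] BK[of x] by (cases x) (auto simp: near_def corners_def)
  qed (force simp: B_def near_def corners_def)
  have "\<exists>r>0. \<forall>x\<in>B. \<exists>U. stable T x U r"
    using fB by (rule uniform_positive) (use stable_exists[OF T Bd] stable_anti in blast)+
  then obtain R where R: "R > 0" "\<forall>x\<in>B. \<exists>U. stable T x U R" by blast
  then obtain U where U: "\<And>x. x \<in> B \<Longrightarrow> stable T x (U x) R" by metis
  have "\<exists>\<sigma>>0. \<forall>z\<in>B \<times> B. fst z \<noteq> snd z \<longrightarrow> \<not> pdist (fst z) (snd z) \<le> ereal \<sigma>"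
  proof (rule uniform_positive)
    show "finite (B \<times> B)" using fB by simp
    fix z assume "z \<in> B \<times> B"
    then have "snd (fst z) \<noteq> -\<infinity>" using Bd[of "fst z"] by auto
    then show "\<exists>r>0. fst z \<noteq> snd z \<longrightarrow> \<not> pdist (fst z) (snd z) \<le> ereal r"
      using pdist_separated[of "fst z" "snd z"] by (cases "fst z = snd z") (auto intro: exI[of _ 1])
  next
    fix z :: "(real \<times> ereal) \<times> (real \<times> ereal)" and r r' :: real
    assume "fst z \<noteq> snd z \<longrightarrow> \<not> pdist (fst z) (snd z) \<le> ereal r" "r' \<le> r"
    then show "fst z \<noteq> snd z \<longrightarrow> \<not> pdist (fst z) (snd z) \<le> ereal r'"
      by (meson ereal_less_eq(3) order_trans)
  qed
  then obtain \<sigma> where \<sigma>: "\<sigma> > 0" "\<And>x y. x \<in> B \<Longrightarrow> y \<in> B \<Longrightarrow> x \<noteq> y \<Longrightarrow> \<not> pdist x y \<le> ereal \<sigma>"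
    by auto
  \<comment> \<open>Half of the separation \<sigma>, so that two balls of radius \<eta> are
    disjoint; division by h turns a distance into a time.\<close>
  define d where "d = min R (\<sigma> / 2) / h"
  have "card (near A T) \<le> card (near A s)" if s: "T \<le> s" "s \<le> 1" "s - T < d" for s
  proof (cases "s = T")
    case False
    have s0: "0 \<le> s" using s T by simp
    define \<eta> where "\<eta> = h * (s - T)"
    have "\<eta> < h * d" unfolding \<eta>_def using s(3) h by (rule mult_strict_left_mono)
    then have "\<eta> < min R (\<sigma> / 2)" using h by (simp add: d_def)
    then have \<eta>: "0 < \<eta>" "\<eta> < R" "\<eta> + \<eta> \<le> \<sigma>" "h * \<bar>T - s\<bar> \<le> \<eta>" using s False h by (auto simp: \<eta>_def)
    note stableD[OF U cat_family[OF s0 s(2)] \<eta>(1,2) inter[OF T s0 s(2) \<eta>(1,4)]]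
    then have "\<forall>x\<in>B. \<exists>F. finite F \<and> card F = ?m x \<and> F \<subseteq> corners (p s) \<and>
        (\<forall>y\<in>F. pdist x (fst y) \<le> ereal \<eta>)"
      by meson
    then obtain F where F: "\<And>x. x \<in> B \<Longrightarrow> finite (F x) \<and> card (F x) = ?m x \<and> F x \<subseteq> corners (p s) \<and>
      (\<forall>y\<in>F x. pdist x (fst y) \<le> ereal \<eta>)" by metis
    have disj: "F x \<inter> F x' = {}" if x: "x \<in> B" "x' \<in> B" "x \<noteq> x'" for x x'
    proof (rule equals0I)
      fix y assume "y \<in> F x \<inter> F x'"
      then have "pdist x (fst y) \<le> ereal \<eta>" "pdist (fst y) x' \<le> ereal \<eta>"
        using F x by (auto simp: pdist_commute)
      then have "pdist x x' \<le> ereal (\<eta> + \<eta>)" by (rule pdist_triangle_le)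
      also have "\<dots> \<le> ereal \<sigma>" using \<eta> by simp
      finally show False using \<sigma>(2)[OF x] by simp
    qed
    have sub: "(\<Union>x\<in>B. F x) \<subseteq> near A s"
    proof
      fix y assume "y \<in> (\<Union>x\<in>B. F x)"
      then obtain x where x: "x \<in> B" "y \<in> F x" by blast
      obtain a where a: "a \<in> A" "pdist a x \<le> ereal (T * h)" using BK[OF x(1)] by (auto simp: nbh_def)
      have "pdist x (fst y) \<le> ereal \<eta>" using F x by blast
      from pdist_triangle_le[OF a(2) this] have "pdist a (fst y) \<le> ereal (s * h)"
        by (simp add: \<eta>_def algebra_simps)
      then have "fst y \<in> nbh A (s * h)" using a(1) by (auto simp: nbh_def)
      moreover have "y \<in> corners (p s)" using F[OF x(1)] x(2) by blast
      ultimately show "y \<in> near A s" by (cases y) (simp add: near_def)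
    qed
    have "card (near A T) = (\<Sum>x\<in>B. card (F x))" unfolding nT using F fB by (subst card_SigmaI) auto
    also have "\<dots> = card (\<Union>x\<in>B. F x)" using fB F disj by (intro card_UN_disjoint[symmetric]) auto
    also have "\<dots> \<le> card (near A s)" using near_upper(1)[OF s0 s(2)] sub by (rule card_mono)
    finally show ?thesis .
  qed simp
  moreover have "d > 0" using R \<sigma> h by (simp add: d_def)
  ultimately show ?thesis by blast
qed

lemma near_mono: "card (near A 0) \<le> card (near A 1)"
proof -
  define P where "P a b \<longleftrightarrow> (0 \<le> a \<longrightarrow> b \<le> 1 \<longrightarrow> card (near A a) \<le> card (near A b))" for a b
  have "(0::real) \<le> 1" by simp
  then have "P 0 1"
  proof (induction rule: Bolzano)
    case (trans a b c)
    then show ?case unfolding P_def by (meson order_trans)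
  next
    case (local T)
    obtain d1 where d1: "d1 > 0" "\<forall>s. 0 \<le> s \<longrightarrow> s \<le> T \<longrightarrow> T - s < d1 \<longrightarrow> card (near A s) \<le> card (near A T)"
      using near_upper(2)[OF local] by blast
    obtain d2 where d2: "d2 > 0" "\<forall>s. T \<le> s \<longrightarrow> s \<le> 1 \<longrightarrow> s - T < d2 \<longrightarrow> card (near A T) \<le> card (near A s)"
      using near_lower[OF local] by blast
    show ?case
    proof (intro exI[of _ "min d1 d2"] conjI allI impI)
      fix a b assume ab: "a \<le> T \<and> T \<le> b \<and> b - a < min d1 d2"
      show "P a b" unfolding P_def
      proof (intro impI)
        assume "0 \<le> a" "b \<le> 1"
        then have "card (near A a) \<le> card (near A T)" "card (near A T) \<le> card (near A b)"
          using ab d1(2) d2(2) by auto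
        then show "card (near A a) \<le> card (near A b)" by (rule order_trans)
      qed
    qed (use d1 d2 in auto)
  qed
  then show ?thesis by (simp add: P_def)
qed

end

section \<open>From counts to a bijection of diagrams\<close>

lemma far_matching:
  defines "L \<equiv> {y \<in> corners (p 0). ereal (fst (fst y) + 2 * h) < snd (fst y)}"
  shows "\<exists>m. inj_on m L \<and> (\<forall>y\<in>L. m y \<in> corners (p 1) \<and> pdist (fst y) (fst (m y)) \<le> ereal h)"
proof -
  have "\<exists>m. inj_on m L \<and> (\<forall>y\<in>L. m y \<in> near {fst y} 1)"
  proof (rule infinite_Hall)
    show "finite (near {fst y} 1)" if "y \<in> L" for y
      using that by (intro near_upper(1)) (auto simp: L_def)
    fix J assume J: "J \<subseteq> L" "finite J"
    have far: "finite (fst ` J)" "\<And>x. x \<in> fst ` J \<Longrightarrow> ereal (fst x + 2 * h) < snd x"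
      using J by (auto simp: L_def)
    \<comment> \<open>At time 0 the radius is 0, so \<open>near\<close> contains \<open>J\<close>
      with its labels; at time 1 it is the union of the candidate sets of the members of
      \<open>J\<close>. Monotonicity between them is Hall's condition.\<close>
    have "pdist x x \<le> ereal (0 * h)" if "x \<in> fst ` J" for x
      using far(2)[OF that] by (cases x; cases "snd x") (auto simp: pdist_le_iff)
    then have "J \<subseteq> near (fst ` J) 0"
      using J(1) by (force simp: near_def nbh_def L_def)
    then have "card J \<le> card (near (fst ` J) 0)"
      using near_upper(1)[OF far, of 0] by (intro card_mono) auto
    also have "\<dots> \<le> card (near (fst ` J) 1)" by (rule near_mono[OF far])
    also have "near (fst ` J) 1 = (\<Union>y\<in>J. near {fst y} 1)" by (auto simp: near_def nbh_def)
    finally show "card J \<le> card (\<Union>y\<in>J. near {fst y} 1)" .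
  qed
  then obtain m where "inj_on m L" "\<forall>y\<in>L. m y \<in> near {fst y} 1" by blast
  then show ?thesis by (intro exI[of _ m]) (auto simp: near_def nbh_def)
qed

end

text \<open>A cornerpoint outside \<open>L\<close> has v - u <= 2 h and can go to the diagonal at
  cost h. Diagonal points stay in place; their infinitely many copies make room for the newcomers.
  Surjectivity is left to the Schroeder-Bernstein argument.\<close>

lemma diagram_injection:
  assumes p: "categorical_pf p"
    and L: "L = {y \<in> corners p. ereal (fst (fst y) + 2 * h) < snd (fst y)}" and h: "0 \<le> h"
    and m: "inj_on m L" "\<And>y. y \<in> L \<Longrightarrow> m y \<in> corners q" "\<And>y. y \<in> L \<Longrightarrow> pdist (fst y) (fst (m y)) \<le> ereal h"
  shows "\<exists>F. inj_on F (diagram p) \<and> F ` diagram p \<subseteq> diagram q \<and>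
    (\<forall>y\<in>diagram p. pdist (fst y) (fst (F y)) \<le> ereal h)"
proof -
  interpret cpf p by unfold_locales fact
  \<comment> \<open>The coordinate of the nearest diagonal point. It matters only outside
    \<open>L\<close>, where heights are finite, since cornerpoints at infinity all belong to
    \<open>L\<close>.\<close>
  define w where "w y = (fst (fst y) + real_of_ereal (snd (fst y))) / 2" for y :: "(real \<times> ereal) \<times> nat"
  define \<iota> where "\<iota> = to_nat_on (corners p)"
  have \<iota>: "inj_on \<iota> (corners p)" unfolding \<iota>_def using countable_corners by (rule inj_on_to_nat_on)
  \<comment> \<open>Cornerpoints moved to the diagonal use even copies, diagonal points odd ones.\<close>
  define F where "F y = (if y \<in> L then m y
     else if y \<in> corners p then ((w y, ereal (w y)), 2 * \<iota> y) else (fst y, Suc (2 * snd y)))" for y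
  define Diag :: "((real \<times> ereal) \<times> nat) set" where "Diag = {((u, ereal u), k) | u k. True}"
  have D: "diagram r = corners r \<union> Diag" for r by (auto simp: diagram_def corners_def Diag_def)
  have disj: "corners r \<inter> Diag = {}" for r by (auto simp: corners_def Diag_def)
  have LC: "L \<subseteq> corners p" by (auto simp: L)
  have F1: "F y = m y \<and> F y \<in> corners q" if "y \<in> L" for y using that m(2) by (simp add: F_def)
  have F2: "F y = ((w y, ereal (w y)), 2 * \<iota> y) \<and> F y \<in> Diag" if "y \<in> corners p - L" for y
    using that by (auto simp: F_def Diag_def)
  have F3: "F y = (fst y, Suc (2 * snd y)) \<and> F y \<in> Diag" if "y \<in> Diag" for y
    using that disj[of p] LC by (auto simp: F_def Diag_def)
  have split: "y \<in> L \<or> y \<in> corners p - L \<or> y \<in> Diag" if "y \<in> diagram p" for y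
    using that by (auto simp: D)
  have "inj_on F (diagram p)"
  proof (rule inj_onI)
    fix y z assume y: "y \<in> diagram p" and z: "z \<in> diagram p" and eq: "F y = F z"
    consider "y \<in> L" "z \<in> L" | "y \<in> corners p - L" "z \<in> corners p - L" | "y \<in> Diag" "z \<in> Diag"
      | "y \<in> corners p - L" "z \<in> Diag" | "y \<in> Diag" "z \<in> corners p - L"
      using split[OF y] split[OF z] F1[of y] F1[of z] F2[of y] F2[of z] F3[of y] F3[of z] disj[of q] eq
      by (metis disjoint_iff)
    then show "y = z"
    proof cases
      case 1 then show ?thesis using F1 eq m(1) by (metis inj_onD)
    next
      case 2
      then have "\<iota> y = \<iota> z" using F2[of y] F2[of z] eq by simp
      then show ?thesis using 2 \<iota> by (auto dest: inj_onD)
    next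
      case 3 then show ?thesis using F3[of y] F3[of z] eq by (simp add: prod_eq_iff)
    next
      case 4
      then have "2 * \<iota> y = Suc (2 * snd z)" using F2[of y] F3[of z] eq by simp
      then have "even (Suc (2 * snd z))" by (metis dvd_triv_left)
      then show ?thesis by simp
    next
      case 5
      then have "2 * \<iota> z = Suc (2 * snd y)" using F2[of z] F3[of y] eq by simp
      then have "even (Suc (2 * snd y))" by (metis dvd_triv_left)
      then show ?thesis by simp
    qed
  qed
  moreover have "F ` diagram p \<subseteq> diagram q"
    using split F1 F2 F3 unfolding D[of q] by blast
  moreover have "pdist (fst y) (fst (F y)) \<le> ereal h" if "y \<in> diagram p" for y
    using split[OF that]
  proof (elim disjE)
    assume "y \<in> L" then show ?thesis using F1 m(3) by simp
  next
    assume y: "y \<in> corners p - L"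
    obtain u v k where yk: "y = ((u, v), k)" by (metis surj_pair)
    have uv: "ereal u < v" "v \<le> ereal (u + 2 * h)" using y yk by (auto simp: corners_def L)
    then obtain v' where v': "v = ereal v'" by (cases v) auto
    have "\<bar>u - (u + v') / 2\<bar> \<le> h" "\<bar>v' - (u + v') / 2\<bar> \<le> h" using uv v' by (auto simp: abs_le_iff field_simps)
    then have "pdist (u, ereal v') ((u + v') / 2, ereal ((u + v') / 2)) \<le> ereal h"
      unfolding pdist_le_iff by blast
    then show ?thesis using F2[OF y] yk v' by (simp add: w_def)
  next
    assume "y \<in> Diag" then show ?thesis using F3[of y] h by (auto simp: Diag_def pdist_le_iff)
  qed
  ultimately show ?thesis by blast
qed

text \<open>The hypotheses of the locale are symmetric under t -> 1 - t, so the reversed path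
  provides the injection in the other direction.\<close>

lemma (in pf_family) bottleneck_le: "bottleneck (diagram (p 0)) (diagram (p 1)) \<le> ereal h"
proof -
  interpret rev: pf_family "\<lambda>t. p (1 - t)" h
    using h cat_family inter by unfold_locales (auto simp: abs_minus_commute)
  define L0 where "L0 = {y \<in> corners (p 0). ereal (fst (fst y) + 2 * h) < snd (fst y)}"
  define L1 where "L1 = {y \<in> corners (p 1). ereal (fst (fst y) + 2 * h) < snd (fst y)}"
  obtain m0 where m0: "inj_on m0 L0" "\<And>y. y \<in> L0 \<Longrightarrow> m0 y \<in> corners (p 1)"
    "\<And>y. y \<in> L0 \<Longrightarrow> pdist (fst y) (fst (m0 y)) \<le> ereal h"
    using far_matching unfolding L0_def by blast
  obtain m1 where m1: "inj_on m1 L1" "\<And>y. y \<in> L1 \<Longrightarrow> m1 y \<in> corners (p 0)"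
    "\<And>y. y \<in> L1 \<Longrightarrow> pdist (fst y) (fst (m1 y)) \<le> ereal h"
    using rev.far_matching unfolding L1_def by auto
  have h0: "0 \<le> h" using h by simp
  obtain F where F: "inj_on F (diagram (p 0))" "F ` diagram (p 0) \<subseteq> diagram (p 1)"
    "\<And>y. y \<in> diagram (p 0) \<Longrightarrow> pdist (fst y) (fst (F y)) \<le> ereal h"
    using diagram_injection[OF cat_family L0_def h0 m0] by auto
  obtain H where H: "inj_on H (diagram (p 1))" "H ` diagram (p 1) \<subseteq> diagram (p 0)"
    "\<And>y. y \<in> diagram (p 1) \<Longrightarrow> pdist (fst y) (fst (H y)) \<le> ereal h"
    using diagram_injection[OF cat_family L1_def h0 m1] by auto
  have "\<exists>\<gamma>. bij_betw \<gamma> (diagram (p 0)) (diagram (p 1)) \<and>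
    (\<forall>y\<in>diagram (p 0). pdist (fst y) (fst (\<gamma> y)) \<le> ereal h)"
    by (rule Schroeder_Bernstein_related[OF F(1,2) H(1,2), of "\<lambda>y z. pdist (fst y) (fst z) \<le> ereal h"])
      (use F(3) H(3) in \<open>auto simp: pdist_commute\<close>)
  then obtain \<gamma> where \<gamma>: "bij_betw \<gamma> (diagram (p 0)) (diagram (p 1))"
    "\<And>y. y \<in> diagram (p 0) \<Longrightarrow> pdist (fst y) (fst (\<gamma> y)) \<le> ereal h" by blast
  have "bottleneck (diagram (p 0)) (diagram (p 1)) \<le> Sup {pdist (fst x) (fst (\<gamma> x)) | x. x \<in> diagram (p 0)}"
    unfolding bottleneck_def using \<gamma>(1) by (intro Inf_lower) blast
  also have "\<dots> \<le> ereal h" using \<gamma>(2) by (intro Sup_least) auto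
  finally show ?thesis .
qed

section \<open>Weighted graphs\<close>

text \<open>Isomorphic filtrations give equality only on Delta^+; the constraints on \<epsilon> in
  \<open>multiplicity\<close> keep all evaluated arguments there.\<close>

lemma diagram_cong:
  assumes "\<And>u v. ereal u < v \<Longrightarrow> p u v = q u v"
  shows "diagram p = diagram q"
proof -
  have "multiplicity p u v = multiplicity q u v" if uv: "ereal u < v" for u v
  proof (cases "v = \<infinity>")
    case True
    have "p (u + \<epsilon>) (ereal (1 / \<epsilon>)) = q (u + \<epsilon>) (ereal (1 / \<epsilon>)) \<and>
        p (u - \<epsilon>) (ereal (1 / \<epsilon>)) = q (u - \<epsilon>) (ereal (1 / \<epsilon>))" if "\<epsilon> > 0" "u + \<epsilon> < 1 / \<epsilon>" for \<epsilon>
      using that by (intro conjI assms) auto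
    then show ?thesis unfolding multiplicity_def using True
      by (simp, intro arg_cong[where f = nat] arg_cong[where f = Inf] Collect_cong) metis
  next
    case False
    then obtain v' where v': "v = ereal v'" using uv by (cases v) auto
    have "p (u + \<epsilon>) (ereal (v' - \<epsilon>)) = q (u + \<epsilon>) (ereal (v' - \<epsilon>)) \<and>
        p (u - \<epsilon>) (ereal (v' - \<epsilon>)) = q (u - \<epsilon>) (ereal (v' - \<epsilon>)) \<and>
        p (u + \<epsilon>) (ereal (v' + \<epsilon>)) = q (u + \<epsilon>) (ereal (v' + \<epsilon>)) \<and>
        p (u - \<epsilon>) (ereal (v' + \<epsilon>)) = q (u - \<epsilon>) (ereal (v' + \<epsilon>))"
      if "\<epsilon> > 0" "u + \<epsilon> < v' - \<epsilon>" for \<epsilon>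
      using that by (intro conjI assms) auto
    then show ?thesis unfolding multiplicity_def v'
      by (simp, intro arg_cong[where f = nat] arg_cong[where f = Inf] Collect_cong) metis
  qed
  then show ?thesis unfolding diagram_def by metis
qed

lemma graph_iso_edges:
  assumes "simple_graph G" "simple_graph G'" "graph_iso \<phi> G G'"
  shows "(`) \<phi> ` snd G = snd G'"
proof (intro equalityI subsetI)
  fix e' assume "e' \<in> (`) \<phi> ` snd G"
  then obtain e where e: "e \<in> snd G" "e' = \<phi> ` e" by blast
  then obtain x y where "e = {x, y}" "x \<in> fst G" "y \<in> fst G"
    using assms(1) unfolding simple_graph_def by blast
  then show "e' \<in> snd G'" using e assms(3) unfolding graph_iso_def by auto
next
  fix e' assume e': "e' \<in> snd G'"
  then obtain x' y' where xy': "e' = {x', y'}" "x' \<in> fst G'" "y' \<in> fst G'"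
    using assms(2) unfolding simple_graph_def by blast
  moreover have "fst G' = \<phi> ` fst G" using assms(3) by (auto simp: graph_iso_def bij_betw_def)
  ultimately obtain x y where "x \<in> fst G" "x' = \<phi> x" "y \<in> fst G" "y' = \<phi> y" by blast
  then have "{x, y} \<in> snd G" "e' = \<phi> ` {x, y}"
    using assms(3) e' xy' unfolding graph_iso_def by auto
  then show "e' \<in> (`) \<phi> ` snd G" by blast
qed

lemma nat_iso_filtrations_pullback:
  assumes "simple_graph G" "simple_graph G'" "graph_iso \<phi> G G'"
  shows "nat_iso_filtrations G (\<lambda>e. f' (\<phi> ` e)) G' f'"
proof -
  have "graph_iso \<phi> (sublevel G (\<lambda>e. f' (\<phi> ` e)) u) (sublevel G' f' u)" for u
  proof (cases "u = \<infinity>")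
    case True then show ?thesis using assms by (simp add: sublevel_def)
  next
    case False
    let ?S = "{e \<in> snd G. ereal (f' (\<phi> ` e)) \<le> u}" and ?S' = "{e \<in> snd G'. ereal (f' e) \<le> u}"
    have V: "\<Union>?S \<subseteq> fst G" using assms(1) unfolding simple_graph_def by auto
    have "?S' = (`) \<phi> ` ?S" unfolding graph_iso_edges[OF assms, symmetric] by auto
    then have "\<Union>?S' = \<phi> ` \<Union>?S" by auto
    moreover have "inj_on \<phi> (\<Union>?S)"
      using assms(3) V unfolding graph_iso_def bij_betw_def by (meson inj_on_subset)
    ultimately have "bij_betw \<phi> (\<Union>?S) (\<Union>?S')" by (simp add: bij_betw_def)
    moreover have "{x, y} \<in> ?S \<longleftrightarrow> {\<phi> x, \<phi> y} \<in> ?S'" if "x \<in> \<Union>?S" "y \<in> \<Union>?S" for x y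
    proof -
      have "x \<in> fst G" "y \<in> fst G" using that V by blast+
      then show ?thesis using assms(3) unfolding graph_iso_def by simp
    qed
    ultimately show ?thesis using False unfolding graph_iso_def sublevel_def by simp
  qed
  then show ?thesis unfolding nat_iso_filtrations_def by (intro exI[of _ "\<lambda>_. \<phi>"]) simp
qed

text \<open>The whole path lives on \<open>G\<close>: balance is applied to \<open>id\<close> and
  the weights \<open>g s\<close>, \<open>g t\<close>, which differ by at most h |s - t|. At t = 1
  the weight is the pullback of \<open>f'\<close>, and invariance under isomorphic filtrations leads
  to \<open>G'\<close>.\<close>

lemma bottleneck_le_of_iso:
  assumes P: "ip_generator P" "balanced P" and G: "simple_graph G" "simple_graph G'"
    and \<phi>: "graph_iso \<phi> G G'" and h: "0 < h" and le: "\<And>e. e \<in> snd G \<Longrightarrow> \<bar>f e - f' (\<phi> ` e)\<bar> \<le> h"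
  shows "bottleneck (diagram (P G f)) (diagram (P G' f')) \<le> ereal h"
proof -
  define g where "g t e = (1 - t) * f e + t * f' (\<phi> ` e)" for t e
  have id: "graph_iso id G G" by (simp add: graph_iso_def)
  have step: "P G (g s) (u - \<eta>) (v + ereal \<eta>) \<le> P G (g t) u v"
    if "0 < \<eta>" "h * \<bar>s - t\<bar> \<le> \<eta>" "ereal u < v" for s t \<eta> u v
  proof -
    have "\<bar>g s e - g t (id ` e)\<bar> \<le> \<eta>" if "e \<in> snd G" for e
    proof -
      have "g s e - g t (id ` e) = - ((s - t) * (f e - f' (\<phi> ` e)))" by (simp add: g_def algebra_simps)
      then have "\<bar>g s e - g t (id ` e)\<bar> = \<bar>s - t\<bar> * \<bar>f e - f' (\<phi> ` e)\<bar>" by (simp add: abs_mult)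
      also have "\<dots> \<le> \<bar>s - t\<bar> * h" using le[OF that] by (intro mult_left_mono) auto
      finally show ?thesis using \<open>h * \<bar>s - t\<bar> \<le> \<eta>\<close> by (simp add: mult.commute)
    qed
    then show ?thesis using P(2) G(1) id that unfolding balanced_def by blast
  qed
  interpret pf_family "\<lambda>t. P G (g t)" h
  proof unfold_locales
    show "categorical_pf (P G (g t))" for t using P(1) G(1) unfolding ip_generator_def by blast
    show "interleaved \<eta> (P G (g s)) (P G (g t))" if "0 < \<eta>" "h * \<bar>s - t\<bar> \<le> \<eta>" for s t \<eta>
      unfolding interleaved_def
    proof (intro allI impI conjI)
      fix u v assume uv: "ereal u < v"
      show "P G (g s) (u - \<eta>) (v + ereal \<eta>) \<le> P G (g t) u v" by (rule step[OF that uv])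
      show "P G (g t) (u - \<eta>) (v + ereal \<eta>) \<le> P G (g s) u v"
        by (rule step[OF that(1) _ uv]) (use that(2) in \<open>simp add: abs_minus_commute\<close>)
    qed
  qed (rule h)
  have "g 0 = f" "g 1 = (\<lambda>e. f' (\<phi> ` e))" by (auto simp: g_def)
  moreover have "diagram (P G (\<lambda>e. f' (\<phi> ` e))) = diagram (P G' f')"
    using P(1) G nat_iso_filtrations_pullback[OF G \<phi>]
    by (intro diagram_cong) (unfold ip_generator_def, blast)
  ultimately show ?thesis using bottleneck_le by simp
qed

theorem theorem1:
  fixes P :: "'v generator"
    and G G' :: "'v graph"
    and f f' :: "'v set \<Rightarrow> real"
  assumes "ip_generator P" and "balanced P"
    and "simple_graph G" and "simple_graph G'"
  shows "bottleneck (diagram (P G f)) (diagram (P G' f'))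
           \<le> natural_pseudodistance G f G' f'"
proof (rule dense_ge)
  fix z assume z: "natural_pseudodistance G f G' f' < z"
  then have iso: "\<exists>\<phi>. graph_iso \<phi> G G'"
    unfolding natural_pseudodistance_def by (auto split: if_splits)
  let ?D = "\<lambda>\<phi>. insert 0 {ereal \<bar>f e - f' (\<phi> ` e)\<bar> | e. e \<in> snd G}"
  from z iso have "Inf {Sup (?D \<phi>) | \<phi>. graph_iso \<phi> G G'} < z"
    by (simp add: natural_pseudodistance_def)
  then obtain \<phi> where \<phi>: "graph_iso \<phi> G G'" "Sup (?D \<phi>) < z" by (auto simp: Inf_less_iff)
  \<comment> \<open>The inserted 0 makes z positive even without edges, so a finite z is a
    legitimate parameter h > 0 for balance.\<close>
  have D: "x < z" if "x \<in> ?D \<phi>" for x using Sup_upper[OF that] \<phi>(2) by (rule order_le_less_trans)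
  show "bottleneck (diagram (P G f)) (diagram (P G' f')) \<le> z"
  proof (cases z)
    case (real h)
    have "0 < h" using D[of 0] real by simp
    moreover have "\<bar>f e - f' (\<phi> ` e)\<bar> \<le> h" if "e \<in> snd G" for e
    proof -
      have "ereal \<bar>f e - f' (\<phi> ` e)\<bar> \<in> ?D \<phi>" using that by blast
      from D[OF this] show ?thesis using real by simp
    qed
    ultimately show ?thesis unfolding real using assms \<phi>(1) by (intro bottleneck_le_of_iso)
  qed (use D[of 0] in auto)
qed

end
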